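(* Let $\Lambda$ be a $k$-graph. The sequence of $\Lambda$-module maps $\big(\square_n\colon\mathcal{P}_n(\Lambda)\to\mathbb{Z}\widetilde Q_n(\widetilde\Lambda)\big)_{n\in\mathbb{Z}}$ constitutes a map of chain complexes, that is, $\square_{n-1}\circ\partial_n^{\mathcal{P}}=\partial_n\circ\square_n$ for all $n\in\mathbb{Z}$.
   Context: $\mathbb{N}$ includes $0$; $e_1,\dots,e_k$ are the canonical generators of $\mathbb{N}^k$. **k-graphs.** A $k$-graph is a countable small category $\Lambda$ with a functor $d\colon\Lambda\to\mathbb{N}^k$ ($\mathbb{N}^k$ a one-object category under addition) with the factorization property: if $d(\lambda)=m+n$ there are unique $\mu,\nu$ with $d(\mu)=m$, $d(\nu)=n$, $\lambda=\mu\nu$. Here $\mu\nu$ is defined iff $s(\mu)=r(\nu)$. $\lambda\in\Lambda$ means $\lambda$ is a morphism; objects are identified with identity morphisms, exactly the morphisms of degree $0$ (vertices). $d_i(\lambda)$ is the $i$-th coordinate of $d(\lambda)$. For $0\le m\le n\le d(\lambda)$, $\lambda(m,n)$ is the unique morphism of degree $n-m$ with $\lambda=\lambda'\lambda(m,n)\lambda''$, $d(\lambda')=m$. The color type of $\lambda$ is $C(\lambda)=\{i:d_i(\lambda)>0\}$. A right $\Lambda$-module is a contravariant functor from $\Lambda$ to abelian groups; module maps are natural transformations; $\mathbb{Z}^\Lambda$ is the constant module $\mathbb{Z}$. **Cubical complex.** For a $k$-graph $\Gamma$ with degree $d$, $Q_n(\Gamma)=\{\eta\in\Gamma:\sum_id_i(\eta)=n,\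 d_i(\eta)\in\{0,1\}\ \forall i\}$, and for $\lambda\in Q_n(\Gamma)$ with $d(\lambda)=\sum_{j=1}^ne_{c_j}$, $c_1<\dots<c_n$, $F^0_j(\lambda)=\lambda(0,d(\lambda)-e_{c_j})$, $F^1_j(\lambda)=\lambda(e_{c_j},d(\lambda))$. $\mathbb{Z}\widetilde Q_n(\Gamma)$ is the free abelian group on $Q_n(\Gamma)$ for $n\ge0$, is $\mathbb{Z}$ for $n=-1$, and $0$ for $n<-1$; $\partial_n(\lambda)=\sum_{j=1}^n\sum_{l=0}^1(-1)^{j+l}F^l_j(\lambda)$ for $n\ge1$, and $\partial_0$ sends each vertex to $1$. For a vertex $v$ of $\Lambda$, $\widetilde\Lambda(v)$ is the $k$-graph whose objects are the morphisms of $\Lambda$ with source $v$ and whose morphisms are the composable pairs $(\eta,\mu)$ with $s(\mu)=v$; $(\eta,\mu)$ has source $\mu$, range $\eta\mu$, degree $d(\eta)$. $\mathbb{Z}\widetilde Q_n(\widetilde\Lambda)$ is the right $\Lambda$-module $v\mapsto\mathbb{Z}\widetilde Q_n(\widetilde\Lambda(v))$, with action $(\eta,\mu)\cdot\lambda=(\eta,\mu\lambda)$ for $n\ge0$, and equal to $\mathbb{Z}^\Lambda$ for $n=-1$. **Simplicial complex.** For $n\ge0$, $\mathcal{P}_n(\Lambda)(v)$ is the free abelian group on $\Lambda^{*(n+1)}v$, the set of composable tuples $(\lambda_0,\dots,\lambda_n)$ ($s(\lambda_{i-1})=r(\lambda_i)$) with $s(\lambda_n)=v$; the action is $(\lambda_0,\dots,\lambda_n)\cdot\lambda=(\lambda_0,\dots,\lambda_n\lambda)$.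 $\mathcal{P}_{-1}(\Lambda)=\mathbb{Z}^\Lambda$ and $\mathcal{P}_n(\Lambda)=0$ for $n<-1$. For $n>0$, $\partial_n^{\mathcal{P}}(\lambda_0,\dots,\lambda_n)=(\lambda_1,\dots,\lambda_n)+\sum_{i=1}^n(-1)^i(\lambda_0,\dots,\lambda_{i-1}\lambda_i,\dots,\lambda_n)$, and $\partial_0^{\mathcal{P}}(\lambda)=1$. **The map $\square_*$.** For a $k$-graph $\Gamma$, an $n$-element set $K\subset\{1,\dots,k\}$ and $\lambda\in\Gamma$ with $C(\lambda)\subset K$, put $e_K=\sum_{j\in K}e_j$ and $\lceil\lambda\rfloor_K=\sum_{m}\lambda(m,m+e_K)\in\mathbb{Z}Q_n(\Gamma)$, summing over $m\in\mathbb{N}^k$ with $0\le m\le d(\lambda)-e_K$ (an empty sum is $0$). For $n\ge0$, $(\lambda_0,\dots,\lambda_n)\in\Lambda^{*(n+1)}v$ and $K$ with $i$-th smallest element $K_{(i)}$, let $\lambda=\lambda_0\cdots\lambda_n$, $b=\sum_{i=1}^n\sum_{j=K_{(i)}+1}^kd_j(\lambda_{i-1})e_j$, $c=\sum_{i=1}^n\sum_{j=K_{(i)}}^kd_j(\lambda_{i-1})e_j$, and $\widehat\square_n(\lambda_0,\dots,\lambda_n;K)=(\lambda(b,c),\lambda(c,d(\lambda)))\in\widetilde\Lambda(v)$, whose color type lies in $K$. Then $(\square_n)_v(\lambda_0,\dots,\lambda_n)=\sum_K\lceil\widehat\square_n(\lambda_0,\dots,\lambda_n;K)\rfloor_K$,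 the sum over all $n$-element subsets $K$ of $\{1,\dots,k\}$, extended linearly. $\square_{-1}=\mathrm{id}_{\mathbb{Z}^\Lambda}$, $\square_n=0$ for $n<-1$. *)

theory Defs
  imports
    "HOL-Library.Function_Algebras"
    "HOL-Library.Countable_Set"
    "HOL-Library.Poly_Mapping"
    "HOL-Algebra.Free_Abelian_Groups"
begin

text \<open>
  Categories are single-sorted: objects are identified with their identity morphisms, so
  \<open>src\<close> and \<open>rng\<close> are morphisms, and \<open>cmp \<Lambda> \<mu> \<nu>\<close> is the composite \<open>\<mu>\<nu>\<close>, meaningful
  when \<open>src \<Lambda> \<mu> = rng \<Lambda> \<nu>\<close>.  Elements of $\mathbb{N}^k$ are functions \<open>nat \<Rightarrow> nat\<close>
  vanishing outside \<open>{1..k}\<close>, with the pointwise order and pointwise operations.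
\<close>

record 'a kgraph =
  mor :: "'a set"
  src :: "'a \<Rightarrow> 'a"
  rng :: "'a \<Rightarrow> 'a"
  cmp :: "'a \<Rightarrow> 'a \<Rightarrow> 'a"
  deg :: "'a \<Rightarrow> nat \<Rightarrow> nat"

definition Nk :: "nat \<Rightarrow> (nat \<Rightarrow> nat) set" where
  "Nk k = {m. \<forall>i. i \<notin> {1..k} \<longrightarrow> m i = 0}"

definition unit_deg :: "nat \<Rightarrow> nat \<Rightarrow> nat" where
  "unit_deg j = (\<lambda>i. if i = j then 1 else 0)"

definition vertices :: "('a, 'b) kgraph_scheme \<Rightarrow> 'a set" where
  "vertices \<Lambda> = {v \<in> mor \<Lambda>. src \<Lambda> v = v}"

locale k_graph =
  fixes k :: nat and \<Lambda> :: "'a kgraph"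
  assumes countable_mor: "countable (mor \<Lambda>)"
    and src_mor: "\<kappa> \<in> mor \<Lambda> \<Longrightarrow> src \<Lambda> \<kappa> \<in> mor \<Lambda>"
    and rng_mor: "\<kappa> \<in> mor \<Lambda> \<Longrightarrow> rng \<Lambda> \<kappa> \<in> mor \<Lambda>"
    and src_src: "\<kappa> \<in> mor \<Lambda> \<Longrightarrow> src \<Lambda> (src \<Lambda> \<kappa>) = src \<Lambda> \<kappa>"
    and rng_src: "\<kappa> \<in> mor \<Lambda> \<Longrightarrow> rng \<Lambda> (src \<Lambda> \<kappa>) = src \<Lambda> \<kappa>"
    and src_rng: "\<kappa> \<in> mor \<Lambda> \<Longrightarrow> src \<Lambda> (rng \<Lambda> \<kappa>) = rng \<Lambda> \<kappa>"
    and rng_rng: "\<kappa> \<in> mor \<Lambda> \<Longrightarrow> rng \<Lambda> (rng \<Lambda> \<kappa>) = rng \<Lambda> \<kappa>"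
    and cmp_mor: "\<lbrakk>\<mu> \<in> mor \<Lambda>; \<nu> \<in> mor \<Lambda>; src \<Lambda> \<mu> = rng \<Lambda> \<nu>\<rbrakk> \<Longrightarrow> cmp \<Lambda> \<mu> \<nu> \<in> mor \<Lambda>"
    and src_cmp: "\<lbrakk>\<mu> \<in> mor \<Lambda>; \<nu> \<in> mor \<Lambda>; src \<Lambda> \<mu> = rng \<Lambda> \<nu>\<rbrakk> \<Longrightarrow> src \<Lambda> (cmp \<Lambda> \<mu> \<nu>) = src \<Lambda> \<nu>"
    and rng_cmp: "\<lbrakk>\<mu> \<in> mor \<Lambda>; \<nu> \<in> mor \<Lambda>; src \<Lambda> \<mu> = rng \<Lambda> \<nu>\<rbrakk> \<Longrightarrow> rng \<Lambda> (cmp \<Lambda> \<mu> \<nu>) = rng \<Lambda> \<mu>"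
    and cmp_src: "\<kappa> \<in> mor \<Lambda> \<Longrightarrow> cmp \<Lambda> \<kappa> (src \<Lambda> \<kappa>) = \<kappa>"
    and rng_cmp_id: "\<kappa> \<in> mor \<Lambda> \<Longrightarrow> cmp \<Lambda> (rng \<Lambda> \<kappa>) \<kappa> = \<kappa>"
    and cmp_assoc: "\<lbrakk>\<kappa> \<in> mor \<Lambda>; \<mu> \<in> mor \<Lambda>; \<nu> \<in> mor \<Lambda>;
          src \<Lambda> \<kappa> = rng \<Lambda> \<mu>; src \<Lambda> \<mu> = rng \<Lambda> \<nu>\<rbrakk>
        \<Longrightarrow> cmp \<Lambda> (cmp \<Lambda> \<kappa> \<mu>) \<nu> = cmp \<Lambda> \<kappa> (cmp \<Lambda> \<mu> \<nu>)"
    and deg_Nk: "\<kappa> \<in> mor \<Lambda> \<Longrightarrow> deg \<Lambda> \<kappa> \<in> Nk k"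
    and deg_src: "\<kappa> \<in> mor \<Lambda> \<Longrightarrow> deg \<Lambda> (src \<Lambda> \<kappa>) = 0"
    and deg_cmp: "\<lbrakk>\<mu> \<in> mor \<Lambda>; \<nu> \<in> mor \<Lambda>; src \<Lambda> \<mu> = rng \<Lambda> \<nu>\<rbrakk>
        \<Longrightarrow> deg \<Lambda> (cmp \<Lambda> \<mu> \<nu>) = deg \<Lambda> \<mu> + deg \<Lambda> \<nu>"
    and factorization: "\<lbrakk>\<kappa> \<in> mor \<Lambda>; m \<in> Nk k; n \<in> Nk k; deg \<Lambda> \<kappa> = m + n\<rbrakk>
        \<Longrightarrow> \<exists>!(\<mu>, \<nu>). \<mu> \<in> mor \<Lambda> \<and> \<nu> \<in> mor \<Lambda> \<and> src \<Lambda> \<mu> = rng \<Lambda> \<nu> \<and>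
              deg \<Lambda> \<mu> = m \<and> deg \<Lambda> \<nu> = n \<and> \<kappa> = cmp \<Lambda> \<mu> \<nu>"

definition color_type :: "nat \<Rightarrow> 'a kgraph \<Rightarrow> 'a \<Rightarrow> nat set" where
  "color_type k \<Lambda> \<kappa> = {i \<in> {1..k}. deg \<Lambda> \<kappa> i > 0}"

text \<open>\<open>seg \<Lambda> \<kappa> m n\<close> is $\lambda(m,n)$, meaningful for $0 \le m \le n \le d(\lambda)$.\<close>

definition seg :: "'a kgraph \<Rightarrow> 'a \<Rightarrow> (nat \<Rightarrow> nat) \<Rightarrow> (nat \<Rightarrow> nat) \<Rightarrow> 'a" where
  "seg \<Lambda> \<kappa> m n = (THE \<tau>. \<tau> \<in> mor \<Lambda> \<and> deg \<Lambda> \<tau> = n - m \<and>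
     (\<exists>\<alpha>\<in>mor \<Lambda>. \<exists>\<beta>\<in>mor \<Lambda>. src \<Lambda> \<alpha> = rng \<Lambda> \<tau> \<and> src \<Lambda> \<tau> = rng \<Lambda> \<beta> \<and>
        deg \<Lambda> \<alpha> = m \<and> \<kappa> = cmp \<Lambda> \<alpha> (cmp \<Lambda> \<tau> \<beta>)))"

text \<open>The $k$-graph $\widetilde\Lambda(v)$.  The object $\mu$ is identified with its identity
  morphism $(r(\mu), \mu)$; composition is $(\eta, \eta'\mu')(\eta',\mu') = (\eta\eta',\mu')$.\<close>

definition path_graph :: "'a kgraph \<Rightarrow> 'a \<Rightarrow> ('a \<times> 'a) kgraph" where
  "path_graph \<Lambda> v =
    \<lparr> mor = {(\<eta>, \<mu>). \<eta> \<in> mor \<Lambda> \<and> \<mu> \<in> mor \<Lambda> \<and> src \<Lambda> \<eta> = rng \<Lambda> \<mu> \<and> src \<Lambda> \<mu> = v},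
      src = (\<lambda>(\<eta>, \<mu>). (rng \<Lambda> \<mu>, \<mu>)),
      rng = (\<lambda>(\<eta>, \<mu>). (rng \<Lambda> (cmp \<Lambda> \<eta> \<mu>), cmp \<Lambda> \<eta> \<mu>)),
      cmp = (\<lambda>(\<eta>, \<mu>) (\<eta>', \<mu>'). (cmp \<Lambda> \<eta> \<eta>', \<mu>')),
      deg = (\<lambda>(\<eta>, \<mu>). deg \<Lambda> \<eta>) \<rparr>"

text \<open>A right module assigns the group \<open>grp M v\<close> to a vertex \<open>v\<close>, and the homomorphism
  \<open>act M \<kappa> : grp M (r \<kappa>) \<rightarrow> grp M (s \<kappa>)\<close>, \<open>x \<mapsto> x \<cdot> \<kappa>\<close>, to a morphism \<open>\<kappa>\<close>.
  Abelian groups are commutative groups in the (multiplicative) sense of \<open>HOL-Algebra\<close>.\<close>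

record ('a, 'm) rmodule =
  grp :: "'a \<Rightarrow> 'm monoid"
  act :: "'a \<Rightarrow> 'm \<Rightarrow> 'm"

definition right_module :: "'a kgraph \<Rightarrow> ('a, 'm) rmodule \<Rightarrow> bool" where
  "right_module \<Lambda> M \<longleftrightarrow>
     (\<forall>v\<in>vertices \<Lambda>. comm_group (grp M v)) \<and>
     (\<forall>\<kappa>\<in>mor \<Lambda>. act M \<kappa> \<in> hom (grp M (rng \<Lambda> \<kappa>)) (grp M (src \<Lambda> \<kappa>))) \<and>
     (\<forall>v\<in>vertices \<Lambda>. \<forall>x\<in>carrier (grp M v). act M v x = x) \<and>
     (\<forall>\<mu>\<in>mor \<Lambda>. \<forall>\<nu>\<in>mor \<Lambda>. src \<Lambda> \<mu> = rng \<Lambda> \<nu> \<longrightarrow>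
        (\<forall>x\<in>carrier (grp M (rng \<Lambda> \<mu>)). act M (cmp \<Lambda> \<mu> \<nu>) x = act M \<nu> (act M \<mu> x)))"

definition module_map ::
    "'a kgraph \<Rightarrow> ('a, 'm) rmodule \<Rightarrow> ('a, 'n) rmodule \<Rightarrow> ('a \<Rightarrow> 'm \<Rightarrow> 'n) \<Rightarrow> bool" where
  "module_map \<Lambda> M N f \<longleftrightarrow> right_module \<Lambda> M \<and> right_module \<Lambda> N \<and>
     (\<forall>v\<in>vertices \<Lambda>. f v \<in> hom (grp M v) (grp N v)) \<and>
     (\<forall>\<kappa>\<in>mor \<Lambda>. \<forall>x\<in>carrier (grp M (rng \<Lambda> \<kappa>)).
        f (src \<Lambda> \<kappa>) (act M \<kappa> x) = act N \<kappa> (f (rng \<Lambda> \<kappa>) x))"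

text \<open>The identities $\partial \circ \partial = 0$ in the two complexes are properties of
  \<open>dC\<close> and \<open>dD\<close> alone, and are not part of this notion.\<close>

definition chain_map ::
    "'a kgraph \<Rightarrow>
     (int \<Rightarrow> ('a, 'm) rmodule) \<Rightarrow> (int \<Rightarrow> 'a \<Rightarrow> 'm \<Rightarrow> 'm) \<Rightarrow>
     (int \<Rightarrow> ('a, 'n) rmodule) \<Rightarrow> (int \<Rightarrow> 'a \<Rightarrow> 'n \<Rightarrow> 'n) \<Rightarrow>
     (int \<Rightarrow> 'a \<Rightarrow> 'm \<Rightarrow> 'n) \<Rightarrow> bool" where
  "chain_map \<Lambda> C dC D dD f \<longleftrightarrow>
     (\<forall>n. module_map \<Lambda> (C n) (D n) (f n)) \<and>
     (\<forall>n. \<forall>v\<in>vertices \<Lambda>. \<forall>x\<in>carrier (grp (C n) v).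
        f (n - 1) v (dC n v x) = dD n v (f n v x))"

text \<open>
  In both complexes all chain groups lie in one type \<open>'x option \<Rightarrow>\<^sub>0 int\<close>:
  a generator \<open>x\<close> of a group of degree at least 0 is represented by \<open>Some x\<close>, while the
  group $\mathbb{Z}$ in degree $-1$ is the free abelian group on \<open>None\<close>, the integer 1
  being \<open>frag_of None\<close>.
\<close>

definition const_module :: "('a, 'x option \<Rightarrow>\<^sub>0 int) rmodule" where
  "const_module = \<lparr> grp = (\<lambda>v. free_Abelian_group {None}), act = (\<lambda>\<kappa> x. x) \<rparr>"

definition cubes :: "nat \<Rightarrow> 'a kgraph \<Rightarrow> nat \<Rightarrow> 'a set" where
  "cubes k \<Gamma> n = {\<eta> \<in> mor \<Gamma>. (\<Sum>i=1..k. deg \<Gamma> \<eta> i) = n \<and> (\<forall>i\<in>{1..k}. deg \<Gamma> \<eta> i \<in> {0, 1})}"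

definition nth_smallest :: "nat set \<Rightarrow> nat \<Rightarrow> nat" where
  "nth_smallest K i = sorted_list_of_set K ! (i - 1)"

text \<open>\<open>face k \<Gamma> l j\<close> is $F^l_j$ for $l \in \{0,1\}$.\<close>

definition face :: "nat \<Rightarrow> 'a kgraph \<Rightarrow> nat \<Rightarrow> nat \<Rightarrow> 'a \<Rightarrow> 'a" where
  "face k \<Gamma> l j \<kappa> =
     (let c = nth_smallest (color_type k \<Gamma> \<kappa>) j
      in if l = 0 then seg \<Gamma> \<kappa> 0 (deg \<Gamma> \<kappa> - unit_deg c) else seg \<Gamma> \<kappa> (unit_deg c) (deg \<Gamma> \<kappa>))"

definition cube_group :: "nat \<Rightarrow> 'a kgraph \<Rightarrow> int \<Rightarrow> ('a option \<Rightarrow>\<^sub>0 int) monoid" where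
  "cube_group k \<Gamma> n = free_Abelian_group
     (if n \<ge> 0 then Some ` cubes k \<Gamma> (nat n) else if n = -1 then {None} else {})"

definition cube_boundary ::
    "nat \<Rightarrow> 'a kgraph \<Rightarrow> int \<Rightarrow> ('a option \<Rightarrow>\<^sub>0 int) \<Rightarrow> ('a option \<Rightarrow>\<^sub>0 int)" where
  "cube_boundary k \<Gamma> n = frag_extend (\<lambda>x. case x of
       None \<Rightarrow> 0
     | Some \<kappa> \<Rightarrow>
         if n \<ge> 1 then \<Sum>j=1..nat n. \<Sum>l=0..1. frag_cmul ((-1) ^ (j + l)) (frag_of (Some (face k \<Gamma> l j \<kappa>)))
         else if n = 0 then frag_of None
         else 0)"

definition cube_module :: "nat \<Rightarrow> 'a kgraph \<Rightarrow> int \<Rightarrow> ('a, ('a \<times> 'a) option \<Rightarrow>\<^sub>0 int) rmodule" where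
  "cube_module k \<Lambda> n =
     (if n = -1 then const_module
      else \<lparr> grp = (\<lambda>v. cube_group k (path_graph \<Lambda> v) n),
             act = (\<lambda>\<kappa>. frag_extend (\<lambda>x. frag_of (map_option (\<lambda>(\<eta>, \<mu>). (\<eta>, cmp \<Lambda> \<mu> \<kappa>)) x))) \<rparr>)"

definition cube_module_boundary ::
    "nat \<Rightarrow> 'a kgraph \<Rightarrow> int \<Rightarrow> 'a \<Rightarrow> (('a \<times> 'a) option \<Rightarrow>\<^sub>0 int) \<Rightarrow> (('a \<times> 'a) option \<Rightarrow>\<^sub>0 int)" where
  "cube_module_boundary k \<Lambda> n v = cube_boundary k (path_graph \<Lambda> v) n"

text \<open>Composable tuples $(\lambda_0,\dots,\lambda_{n-1})$ are lists, with
  $\lambda_i$ at position \<open>i\<close>.\<close>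

definition tuples :: "'a kgraph \<Rightarrow> nat \<Rightarrow> 'a \<Rightarrow> 'a list set" where
  "tuples \<Lambda> n v = {ls. length ls = n \<and> ls \<noteq> [] \<and> set ls \<subseteq> mor \<Lambda> \<and>
     (\<forall>i\<in>{1..<n}. src \<Lambda> (ls ! (i - 1)) = rng \<Lambda> (ls ! i)) \<and> src \<Lambda> (last ls) = v}"

definition simplex_module :: "'a kgraph \<Rightarrow> int \<Rightarrow> ('a, 'a list option \<Rightarrow>\<^sub>0 int) rmodule" where
  "simplex_module \<Lambda> n =
     (if n = -1 then const_module
      else \<lparr> grp = (\<lambda>v. free_Abelian_group (if n \<ge> 0 then Some ` tuples \<Lambda> (nat n + 1) v else {})),
             act = (\<lambda>\<kappa>. frag_extend (\<lambda>x. frag_of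
                     (map_option (\<lambda>ls. butlast ls @ [cmp \<Lambda> (last ls) \<kappa>]) x))) \<rparr>)"

definition merge :: "'a kgraph \<Rightarrow> nat \<Rightarrow> 'a list \<Rightarrow> 'a list" where
  "merge \<Lambda> i ls = take (i - 1) ls @ [cmp \<Lambda> (ls ! (i - 1)) (ls ! i)] @ drop (i + 1) ls"

definition simplex_boundary ::
    "'a kgraph \<Rightarrow> int \<Rightarrow> 'a \<Rightarrow> ('a list option \<Rightarrow>\<^sub>0 int) \<Rightarrow> ('a list option \<Rightarrow>\<^sub>0 int)" where
  "simplex_boundary \<Lambda> n v = frag_extend (\<lambda>x. case x of
       None \<Rightarrow> 0
     | Some ls \<Rightarrow>
         if n \<ge> 1 then frag_of (Some (tl ls)) +
           (\<Sum>i=1..nat n. frag_cmul ((-1) ^ i) (frag_of (Some (merge \<Lambda> i ls))))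
         else if n = 0 then frag_of None
         else 0)"

definition eK :: "nat set \<Rightarrow> nat \<Rightarrow> nat" where
  "eK K = (\<Sum>j\<in>K. unit_deg j)"

text \<open>The range $0 \le m \le d(\lambda) - e_K$ is phrased as $m + e_K \le d(\lambda)$,
  because subtraction on \<open>nat\<close> is truncated.\<close>

definition bracket :: "'a kgraph \<Rightarrow> 'a \<Rightarrow> nat set \<Rightarrow> ('a option \<Rightarrow>\<^sub>0 int)" where
  "bracket \<Gamma> \<kappa> K = (\<Sum>m | m + eK K \<le> deg \<Gamma> \<kappa>. frag_of (Some (seg \<Gamma> \<kappa> m (m + eK K))))"

fun composite :: "'a kgraph \<Rightarrow> 'a list \<Rightarrow> 'a" where
  "composite \<Lambda> [] = undefined"
| "composite \<Lambda> [x] = x"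
| "composite \<Lambda> (x # y # zs) = cmp \<Lambda> x (composite \<Lambda> (y # zs))"

definition square_hat :: "nat \<Rightarrow> 'a kgraph \<Rightarrow> nat \<Rightarrow> 'a list \<Rightarrow> nat set \<Rightarrow> 'a \<times> 'a" where
  "square_hat k \<Lambda> n ls K =
     (let l = composite \<Lambda> ls;
          b = (\<lambda>p. \<Sum>i=1..n. \<Sum>j=nth_smallest K i + 1..k. deg \<Lambda> (ls ! (i - 1)) j * unit_deg j p);
          c = (\<lambda>p. \<Sum>i=1..n. \<Sum>j=nth_smallest K i..k. deg \<Lambda> (ls ! (i - 1)) j * unit_deg j p)
      in (seg \<Lambda> l b c, seg \<Lambda> l c (deg \<Lambda> l)))"

text \<open>In degree $-1$ this is the identity of $\mathbb{Z}$, which is generated by \<open>None\<close> on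
  both sides, though at different types.\<close>

definition square ::
    "nat \<Rightarrow> 'a kgraph \<Rightarrow> int \<Rightarrow> 'a \<Rightarrow> ('a list option \<Rightarrow>\<^sub>0 int) \<Rightarrow> (('a \<times> 'a) option \<Rightarrow>\<^sub>0 int)" where
  "square k \<Lambda> n v = frag_extend (\<lambda>x. case x of
       None \<Rightarrow> if n = -1 then frag_of None else 0
     | Some ls \<Rightarrow>
         if n \<ge> 0 then \<Sum>K | K \<subseteq> {1..k} \<and> card K = nat n.
           bracket (path_graph \<Lambda> v) (square_hat k \<Lambda> (nat n) ls K) K
         else 0)"

end

theory Submission
  imports Defs
begin

text \<open>
  Fix a tuple with composite \<open>\<lambda>\<close>, and let \<open>D\<^sub>q\<close> (\<open>cumdeg\<close>) be the degree of the product of its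
  first \<open>q\<close> entries.  Write \<open>r\<^sub>K(j)\<close> (\<open>rank\<close>) for the number of elements of \<open>K\<close> below \<open>j\<close>, and
  \<open>[m, K]\<close> (\<open>cube\<close>) for the cube of colours \<open>K\<close> at position \<open>m\<close> of \<open>\<lambda>\<close>.  Unwinding the
  definitions, \<open>square\<close> sends the tuple to the sum over \<open>K\<close> of all \<open>[m, K]\<close> with \<open>m\<close> in a box:
  the coordinate \<open>m\<^sub>j\<close> equals \<open>D\<^sub>q(j)\<close> for \<open>j\<close> outside \<open>K\<close> and runs from \<open>D\<^sub>q(j)\<close> up to but
  excluding \<open>D\<^sub>q\<^sub>+\<^sub>1(j)\<close> for \<open>j\<close> in \<open>K\<close>, where \<open>q = r\<^sub>K(j)\<close> (\<open>square_of_tuple\<close>).  From here on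
  the statement is about boxes.

  The two faces of \<open>[m, K]\<close> in the direction \<open>c\<close> of \<open>K\<close> are \<open>[m, L]\<close> and \<open>[m + e\<^sub>c, L]\<close> with
  \<open>L = K - {c}\<close>, so the sum over the box telescopes in that direction and only its two walls
  remain.  Let \<open>S\<^sub>L(t)\<close> be the sum of the \<open>[m, L]\<close> over the box for \<open>L\<close> in which
  the stage \<open>q\<close> is raised by one for the colours \<open>j \<ge> t\<close>.  Since \<open>r\<^sub>K(j)\<close> exceeds \<open>r\<^sub>L(j)\<close> by one exactly
  for \<open>j > c\<close>, the two walls are \<open>S\<^sub>L(c + 1)\<close> and \<open>S\<^sub>L(c)\<close> (\<open>cube_boundary_cube_sum\<close>).  Thus the
  boundary of the image is the sum over \<open>L\<close> and over \<open>c\<close> outside \<open>L\<close> of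
  \<open>(-1)\<close> to the power \<open>r\<^sub>L(c) + 1\<close> times \<open>S\<^sub>L(c + 1) - S\<^sub>L(c)\<close>.

  On the other side, dropping the first entry of the tuple gives \<open>S\<^sub>L(1)\<close>; merging the
  two entries that meet at the end of stage \<open>r\<^sub>L(c)\<close>, for \<open>c\<close> in \<open>L\<close>, joins two adjacent
  intervals in the direction \<open>c\<close> and gives \<open>S\<^sub>L(c) + S\<^sub>L(c + 1)\<close>; merging the last two entries gives \<open>S\<^sub>L(k + 1)\<close>
  (\<open>cube_sum_tl\<close>, \<open>sum_stage_box_skip\<close>, \<open>cube_sum_last_merge\<close>).  Both sides agree because
  \<open>T(c)\<close>, defined as \<open>(-1)\<close> to the power \<open>r\<^sub>L(c)\<close> times \<open>S\<^sub>L(c)\<close>, has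
  \<open>T(c) - T(c + 1)\<close> equal to the term at \<open>c\<close> of the first side when \<open>c\<close> is outside \<open>L\<close>, and to
  minus the term at \<open>c\<close> of the second when \<open>c\<close> is in \<open>L\<close>, while the sum over all \<open>c\<close>
  telescopes to \<open>T(1) - T(k + 1)\<close> (\<open>alternating_telescope\<close>).

  Naturality holds because the right action changes only the last entry, which is not seen by
  the \<open>D\<^sub>q\<close> that bound the boxes.
\<close>

section \<open>Segments in a k-graph\<close>

lemma Nk_downward: "n \<in> Nk k \<Longrightarrow> m \<le> n \<Longrightarrow> m \<in> Nk k"
  unfolding Nk_def le_fun_def by (smt (verit) le_zero_eq mem_Collect_eq)

lemma Nk_diff: "n \<in> Nk k \<Longrightarrow> n - m \<in> Nk k"
  by (auto simp: Nk_def)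

lemma fun_add_diff_inverse: "m \<le> n \<Longrightarrow> m + (n - m) = (n :: 'i \<Rightarrow> nat)"
  by (auto simp: le_fun_def fun_eq_iff)

lemma fun_add_le_iff: "b \<le> c \<Longrightarrow> q \<le> c - b \<longleftrightarrow> b + q \<le> (c :: 'i \<Rightarrow> nat)"
  by (simp add: le_fun_def le_diff_conv2 add.commute)

lemma Ex1_pair_unique: "\<exists>!(x, y). P x y \<Longrightarrow> P a b \<Longrightarrow> P c d \<Longrightarrow> a = c \<and> b = d"
  by (auto simp: Ex1_def)

lemma Ex1_pairE: "\<exists>!(x, y). P x y \<Longrightarrow> (\<And>x y. P x y \<Longrightarrow> thesis) \<Longrightarrow> thesis"
  by (auto simp: Ex1_def)

context k_graph
begin

lemma factorization_unique:
  assumes "\<mu> \<in> mor \<Lambda>" "\<nu> \<in> mor \<Lambda>" "src \<Lambda> \<mu> = rng \<Lambda> \<nu>"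
    and "\<mu>' \<in> mor \<Lambda>" "\<nu>' \<in> mor \<Lambda>" "src \<Lambda> \<mu>' = rng \<Lambda> \<nu>'"
    and eq: "cmp \<Lambda> \<mu> \<nu> = cmp \<Lambda> \<mu>' \<nu>'" and deg: "deg \<Lambda> \<mu> = deg \<Lambda> \<mu>'"
  shows "\<mu> = \<mu>' \<and> \<nu> = \<nu>'"
proof -
  have "deg \<Lambda> \<mu> + deg \<Lambda> \<nu> = deg \<Lambda> \<mu> + deg \<Lambda> \<nu>'"
    using assms deg_cmp by metis
  then have "deg \<Lambda> \<nu>' = deg \<Lambda> \<nu>" by simp
  then show ?thesis
    by (intro Ex1_pair_unique[OF factorization[OF cmp_mor[OF assms(1-3)] deg_Nk[OF assms(1)]
            deg_Nk[OF assms(2)] deg_cmp[OF assms(1-3)]]] conjI)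
      (use assms in simp_all)
qed

lemma factorE:
  assumes "\<kappa> \<in> mor \<Lambda>" "m \<le> deg \<Lambda> \<kappa>"
  obtains \<mu> \<nu> where "\<mu> \<in> mor \<Lambda>" "\<nu> \<in> mor \<Lambda>" "src \<Lambda> \<mu> = rng \<Lambda> \<nu>" "deg \<Lambda> \<mu> = m"
    "deg \<Lambda> \<nu> = deg \<Lambda> \<kappa> - m" "\<kappa> = cmp \<Lambda> \<mu> \<nu>"
proof -
  have "m \<in> Nk k" "deg \<Lambda> \<kappa> - m \<in> Nk k" "deg \<Lambda> \<kappa> = m + (deg \<Lambda> \<kappa> - m)"
    using Nk_downward Nk_diff deg_Nk assms fun_add_diff_inverse by metis+
  from factorization[OF assms(1) this] show thesis
    by (rule Ex1_pairE) (use that in blast)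
qed

lemma seg_eqI:
  assumes "\<alpha> \<in> mor \<Lambda>" "\<tau> \<in> mor \<Lambda>" "\<beta> \<in> mor \<Lambda>" "src \<Lambda> \<alpha> = rng \<Lambda> \<tau>" "src \<Lambda> \<tau> = rng \<Lambda> \<beta>"
    and "\<kappa> = cmp \<Lambda> \<alpha> (cmp \<Lambda> \<tau> \<beta>)" "deg \<Lambda> \<alpha> = m" "deg \<Lambda> \<alpha> + deg \<Lambda> \<tau> = n"
  shows "seg \<Lambda> \<kappa> m n = \<tau>"
  unfolding seg_def
proof (rule the_equality)
  have "n = m + deg \<Lambda> \<tau>" using assms by simp
  then have "deg \<Lambda> \<tau> = n - m" by (simp add: fun_eq_iff)
  then show "\<tau> \<in> mor \<Lambda> \<and> deg \<Lambda> \<tau> = n - m \<and>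
     (\<exists>\<alpha>\<in>mor \<Lambda>. \<exists>\<beta>\<in>mor \<Lambda>. src \<Lambda> \<alpha> = rng \<Lambda> \<tau> \<and> src \<Lambda> \<tau> = rng \<Lambda> \<beta> \<and>
        deg \<Lambda> \<alpha> = m \<and> \<kappa> = cmp \<Lambda> \<alpha> (cmp \<Lambda> \<tau> \<beta>))"
    using assms by metis
  fix \<tau>'
  assume "\<tau>' \<in> mor \<Lambda> \<and> deg \<Lambda> \<tau>' = n - m \<and>
     (\<exists>\<alpha>\<in>mor \<Lambda>. \<exists>\<beta>\<in>mor \<Lambda>. src \<Lambda> \<alpha> = rng \<Lambda> \<tau>' \<and> src \<Lambda> \<tau>' = rng \<Lambda> \<beta> \<and>
        deg \<Lambda> \<alpha> = m \<and> \<kappa> = cmp \<Lambda> \<alpha> (cmp \<Lambda> \<tau>' \<beta>))"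
  then obtain \<alpha>' \<beta>' where t: "\<tau>' \<in> mor \<Lambda>" "deg \<Lambda> \<tau>' = n - m"
    "\<alpha>' \<in> mor \<Lambda>" "\<beta>' \<in> mor \<Lambda>" "src \<Lambda> \<alpha>' = rng \<Lambda> \<tau>'" "src \<Lambda> \<tau>' = rng \<Lambda> \<beta>'"
    "deg \<Lambda> \<alpha>' = m" "\<kappa> = cmp \<Lambda> \<alpha>' (cmp \<Lambda> \<tau>' \<beta>')" by auto
  have "cmp \<Lambda> \<tau> \<beta> = cmp \<Lambda> \<tau>' \<beta>'"
    using factorization_unique[of \<alpha> "cmp \<Lambda> \<tau> \<beta>" \<alpha>' "cmp \<Lambda> \<tau>' \<beta>'"] assms t
    by (simp add: cmp_mor rng_cmp)
  then show "\<tau>' = \<tau>"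
    using factorization_unique[of \<tau> \<beta> \<tau>' \<beta>'] \<open>deg \<Lambda> \<tau> = n - m\<close> assms t by simp
qed

lemma factor3E:
  assumes "\<kappa> \<in> mor \<Lambda>" "m \<le> n" "n \<le> deg \<Lambda> \<kappa>"
  obtains \<alpha> \<tau> \<beta> where "\<alpha> \<in> mor \<Lambda>" "\<tau> \<in> mor \<Lambda>" "\<beta> \<in> mor \<Lambda>"
    "src \<Lambda> \<alpha> = rng \<Lambda> \<tau>" "src \<Lambda> \<tau> = rng \<Lambda> \<beta>"
    "\<kappa> = cmp \<Lambda> \<alpha> (cmp \<Lambda> \<tau> \<beta>)" "deg \<Lambda> \<alpha> = m" "deg \<Lambda> \<tau> = n - m" "deg \<Lambda> \<beta> = deg \<Lambda> \<kappa> - n"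
    "seg \<Lambda> \<kappa> m n = \<tau>"
proof -
  obtain \<alpha> \<gamma> where 1: "\<alpha> \<in> mor \<Lambda>" "\<gamma> \<in> mor \<Lambda>" "src \<Lambda> \<alpha> = rng \<Lambda> \<gamma>" "deg \<Lambda> \<alpha> = m"
    "deg \<Lambda> \<gamma> = deg \<Lambda> \<kappa> - m" "\<kappa> = cmp \<Lambda> \<alpha> \<gamma>"
    using factorE[OF assms(1)] order_trans[OF assms(2,3)] by metis
  have "n - m \<le> deg \<Lambda> \<gamma>" using assms 1(5) by (simp add: le_fun_def diff_le_mono)
  then obtain \<tau> \<beta> where 2: "\<tau> \<in> mor \<Lambda>" "\<beta> \<in> mor \<Lambda>" "src \<Lambda> \<tau> = rng \<Lambda> \<beta>" "deg \<Lambda> \<tau> = n - m"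
    "deg \<Lambda> \<beta> = deg \<Lambda> \<gamma> - (n - m)" "\<gamma> = cmp \<Lambda> \<tau> \<beta>"
    using factorE[OF 1(2)] by metis
  have 3: "src \<Lambda> \<alpha> = rng \<Lambda> \<tau>" using 1 2 rng_cmp by metis
  have 4: "deg \<Lambda> \<beta> = deg \<Lambda> \<kappa> - n" using 1 2 assms by (auto simp: fun_eq_iff le_fun_def)
  have "seg \<Lambda> \<kappa> m n = \<tau>"
    by (rule seg_eqI[of \<alpha> \<tau> \<beta>]) (use 1 2 3 assms fun_add_diff_inverse in auto)
  then show thesis using that 1 2 3 4 by blast
qed

lemma
  assumes "\<kappa> \<in> mor \<Lambda>" "m \<le> n" "n \<le> deg \<Lambda> \<kappa>"
  shows seg_mor: "seg \<Lambda> \<kappa> m n \<in> mor \<Lambda>"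
    and deg_seg: "deg \<Lambda> (seg \<Lambda> \<kappa> m n) = n - m"
  by (rule factor3E[OF assms], simp)+

lemma deg_rng: "\<kappa> \<in> mor \<Lambda> \<Longrightarrow> deg \<Lambda> (rng \<Lambda> \<kappa>) = 0"
  using deg_src rng_mor src_rng by metis

text \<open>Endpoints of segments are put in the normal form \<open>\<lambda>(n,n)\<close>, so that composability of
  segments becomes a matter of rewriting.\<close>

lemma
  assumes "\<kappa> \<in> mor \<Lambda>" "m \<le> n" "n \<le> deg \<Lambda> \<kappa>"
  shows rng_seg: "rng \<Lambda> (seg \<Lambda> \<kappa> m n) = seg \<Lambda> \<kappa> m m"
    and src_seg: "src \<Lambda> (seg \<Lambda> \<kappa> m n) = seg \<Lambda> \<kappa> n n"
proof -
  obtain \<alpha> \<tau> \<beta> where d: "\<alpha> \<in> mor \<Lambda>" "\<tau> \<in> mor \<Lambda>" "\<beta> \<in> mor \<Lambda>"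
    "src \<Lambda> \<alpha> = rng \<Lambda> \<tau>" "src \<Lambda> \<tau> = rng \<Lambda> \<beta>"
    "\<kappa> = cmp \<Lambda> \<alpha> (cmp \<Lambda> \<tau> \<beta>)" "deg \<Lambda> \<alpha> = m" "deg \<Lambda> \<tau> = n - m" "seg \<Lambda> \<kappa> m n = \<tau>"
    using factor3E[OF assms] by metis
  have "cmp \<Lambda> (rng \<Lambda> \<tau>) (cmp \<Lambda> \<tau> \<beta>) = cmp \<Lambda> \<tau> \<beta>"
    using rng_cmp_id[OF cmp_mor[OF d(2,3,5)]] rng_cmp[OF d(2,3,5)] by simp
  then have "seg \<Lambda> \<kappa> m m = rng \<Lambda> \<tau>"
    by (intro seg_eqI[of \<alpha> "rng \<Lambda> \<tau>" "cmp \<Lambda> \<tau> \<beta>"])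
      (simp_all add: d(1-8) rng_mor cmp_mor rng_rng src_rng rng_cmp deg_rng)
  moreover have "seg \<Lambda> \<kappa> n n = rng \<Lambda> \<beta>"
    by (rule seg_eqI[of "cmp \<Lambda> \<alpha> \<tau>" _ \<beta>])
      (simp_all add: d(1-8) rng_mor cmp_mor rng_rng src_rng src_cmp deg_cmp deg_rng rng_cmp_id cmp_assoc
        fun_add_diff_inverse[OF assms(2)])
  ultimately show "rng \<Lambda> (seg \<Lambda> \<kappa> m n) = seg \<Lambda> \<kappa> m m" "src \<Lambda> (seg \<Lambda> \<kappa> m n) = seg \<Lambda> \<kappa> n n"
    using d(5,9) by simp_all
qed

lemma seg_suffix:
  assumes "\<alpha> \<in> mor \<Lambda>" "\<beta> \<in> mor \<Lambda>" "src \<Lambda> \<alpha> = rng \<Lambda> \<beta>" "m \<le> n" "n \<le> deg \<Lambda> \<beta>"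
  shows "seg \<Lambda> (cmp \<Lambda> \<alpha> \<beta>) (deg \<Lambda> \<alpha> + m) (deg \<Lambda> \<alpha> + n) = seg \<Lambda> \<beta> m n"
proof -
  obtain \<gamma> \<tau> \<delta> where d: "\<gamma> \<in> mor \<Lambda>" "\<tau> \<in> mor \<Lambda>" "\<delta> \<in> mor \<Lambda>"
    "src \<Lambda> \<gamma> = rng \<Lambda> \<tau>" "src \<Lambda> \<tau> = rng \<Lambda> \<delta>"
    "\<beta> = cmp \<Lambda> \<gamma> (cmp \<Lambda> \<tau> \<delta>)" "deg \<Lambda> \<gamma> = m" "deg \<Lambda> \<tau> = n - m" "seg \<Lambda> \<beta> m n = \<tau>"
    using factor3E[OF assms(2,4,5)] by metis
  have r: "src \<Lambda> \<alpha> = rng \<Lambda> \<gamma>" using d assms by (simp add: rng_cmp cmp_mor)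
  show ?thesis unfolding d(9)
  proof (rule seg_eqI[of "cmp \<Lambda> \<alpha> \<gamma>" \<tau> \<delta>])
    have "m + (n - m) = n" using assms(4) by (rule fun_add_diff_inverse)
    then show "deg \<Lambda> (cmp \<Lambda> \<alpha> \<gamma>) + deg \<Lambda> \<tau> = deg \<Lambda> \<alpha> + n"
      using d r assms by (simp add: deg_cmp add.assoc)
  qed (use d r assms in \<open>simp_all add: cmp_mor src_cmp rng_cmp deg_cmp cmp_assoc\<close>)
qed

lemma seg_prefix:
  assumes "\<alpha> \<in> mor \<Lambda>" "\<beta> \<in> mor \<Lambda>" "src \<Lambda> \<alpha> = rng \<Lambda> \<beta>" "m \<le> n" "n \<le> deg \<Lambda> \<alpha>"
  shows "seg \<Lambda> (cmp \<Lambda> \<alpha> \<beta>) m n = seg \<Lambda> \<alpha> m n"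
proof -
  obtain \<gamma> \<tau> \<delta> where d: "\<gamma> \<in> mor \<Lambda>" "\<tau> \<in> mor \<Lambda>" "\<delta> \<in> mor \<Lambda>"
    "src \<Lambda> \<gamma> = rng \<Lambda> \<tau>" "src \<Lambda> \<tau> = rng \<Lambda> \<delta>"
    "\<alpha> = cmp \<Lambda> \<gamma> (cmp \<Lambda> \<tau> \<delta>)" "deg \<Lambda> \<gamma> = m" "deg \<Lambda> \<tau> = n - m" "seg \<Lambda> \<alpha> m n = \<tau>"
    using factor3E[OF assms(1,4,5)] by metis
  have r: "src \<Lambda> \<delta> = rng \<Lambda> \<beta>" using d assms by (simp add: rng_cmp cmp_mor src_cmp)
  show ?thesis unfolding d(9)
    by (rule seg_eqI[of \<gamma> \<tau> "cmp \<Lambda> \<delta> \<beta>"])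
      (use d r assms fun_add_diff_inverse[OF assms(4)] in
        \<open>simp_all add: cmp_mor src_cmp rng_cmp deg_cmp cmp_assoc\<close>)
qed

lemma seg_full: "\<kappa> \<in> mor \<Lambda> \<Longrightarrow> seg \<Lambda> \<kappa> 0 (deg \<Lambda> \<kappa>) = \<kappa>"
  by (rule seg_eqI[of "rng \<Lambda> \<kappa>" \<kappa> "src \<Lambda> \<kappa>"])
    (simp_all add: rng_mor src_mor src_rng rng_src cmp_src rng_cmp_id deg_rng)

lemma seg_deg_deg: "\<kappa> \<in> mor \<Lambda> \<Longrightarrow> seg \<Lambda> \<kappa> (deg \<Lambda> \<kappa>) (deg \<Lambda> \<kappa>) = src \<Lambda> \<kappa>"
  using src_seg[of \<kappa> 0 "deg \<Lambda> \<kappa>"] by (simp add: seg_full le_fun_def)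

lemma seg_seg:
  assumes "\<kappa> \<in> mor \<Lambda>" "p \<le> q" "q \<le> deg \<Lambda> \<kappa>" "m \<le> n" "n \<le> q - p"
  shows "seg \<Lambda> (seg \<Lambda> \<kappa> p q) m n = seg \<Lambda> \<kappa> (p + m) (p + n)"
proof -
  obtain \<alpha> \<tau> \<beta> where d: "\<alpha> \<in> mor \<Lambda>" "\<tau> \<in> mor \<Lambda>" "\<beta> \<in> mor \<Lambda>"
    "src \<Lambda> \<alpha> = rng \<Lambda> \<tau>" "src \<Lambda> \<tau> = rng \<Lambda> \<beta>"
    "\<kappa> = cmp \<Lambda> \<alpha> (cmp \<Lambda> \<tau> \<beta>)" "deg \<Lambda> \<alpha> = p" "deg \<Lambda> \<tau> = q - p" "seg \<Lambda> \<kappa> p q = \<tau>"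
    using factor3E[OF assms(1-3)] by metis
  have "n \<le> deg \<Lambda> \<tau>" using d assms by simp
  then have "n \<le> deg \<Lambda> (cmp \<Lambda> \<tau> \<beta>)" using d by (simp add: deg_cmp le_fun_def trans_le_add1)
  then have "seg \<Lambda> \<kappa> (p + m) (p + n) = seg \<Lambda> (cmp \<Lambda> \<tau> \<beta>) m n"
    using seg_suffix[of \<alpha> "cmp \<Lambda> \<tau> \<beta>" m n] d assms by (simp add: cmp_mor rng_cmp)
  also have "\<dots> = seg \<Lambda> \<tau> m n" using seg_prefix[of \<tau> \<beta> m n] d assms by simp
  finally show ?thesis using d by simp
qed

lemma cmp_seg_seg:
  assumes "\<kappa> \<in> mor \<Lambda>" "m \<le> n" "n \<le> p" "p \<le> deg \<Lambda> \<kappa>"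
  shows "cmp \<Lambda> (seg \<Lambda> \<kappa> m n) (seg \<Lambda> \<kappa> n p) = seg \<Lambda> \<kappa> m p"
proof -
  define \<tau> where "\<tau> = seg \<Lambda> \<kappa> m p"
  have t: "\<tau> \<in> mor \<Lambda>" "deg \<Lambda> \<tau> = p - m"
    unfolding \<tau>_def using seg_mor deg_seg assms order_trans by metis+
  have nm: "n - m \<le> deg \<Lambda> \<tau>" using t assms by (simp add: le_fun_def diff_le_mono)
  obtain \<mu> \<nu> where 1: "\<mu> \<in> mor \<Lambda>" "\<nu> \<in> mor \<Lambda>" "src \<Lambda> \<mu> = rng \<Lambda> \<nu>" "deg \<Lambda> \<mu> = n - m"
    "deg \<Lambda> \<nu> = deg \<Lambda> \<tau> - (n - m)" "\<tau> = cmp \<Lambda> \<mu> \<nu>"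
    using factorE[OF t(1) nm] by metis
  have e: "n - m + deg \<Lambda> \<nu> = deg \<Lambda> \<tau>" using 1(5) nm fun_add_diff_inverse by metis
  have mp: "m \<le> p" using assms by simp
  have "seg \<Lambda> \<kappa> m n = seg \<Lambda> \<tau> 0 (n - m)"
    using seg_seg[OF assms(1) mp assms(4), of 0 "n - m"] nm t fun_add_diff_inverse[OF assms(2)]
    by (simp add: \<tau>_def le_fun_def)
  also have "\<dots> = \<mu>" using seg_prefix[of \<mu> \<nu> 0 "n - m"] 1 seg_full[of \<mu>] by (simp add: le_fun_def)
  finally have A: "seg \<Lambda> \<kappa> m n = \<mu>" .
  have "seg \<Lambda> \<kappa> n p = seg \<Lambda> \<tau> (n - m) (p - m)"
    using seg_seg[OF assms(1) mp assms(4), of "n - m" "p - m"] nm t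
      fun_add_diff_inverse[OF assms(2)] fun_add_diff_inverse[OF mp]
    by (simp add: \<tau>_def)
  also have "\<dots> = \<nu>" using seg_suffix[of \<mu> \<nu> 0 "deg \<Lambda> \<nu>"] 1 seg_full[of \<nu>] e t by (simp add: le_fun_def)
  finally have B: "seg \<Lambda> \<kappa> n p = \<nu>" .
  show "cmp \<Lambda> (seg \<Lambda> \<kappa> m n) (seg \<Lambda> \<kappa> n p) = seg \<Lambda> \<kappa> m p"
    using A B 1 \<tau>_def by simp
qed

end

section \<open>The path k-graph\<close>

context k_graph
begin

lemma path_graph_simps [simp]:
  "(\<eta>, \<mu>) \<in> mor (path_graph \<Lambda> v) \<longleftrightarrow>
     \<eta> \<in> mor \<Lambda> \<and> \<mu> \<in> mor \<Lambda> \<and> src \<Lambda> \<eta> = rng \<Lambda> \<mu> \<and> src \<Lambda> \<mu> = v"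
  "src (path_graph \<Lambda> v) (\<eta>, \<mu>) = (rng \<Lambda> \<mu>, \<mu>)"
  "rng (path_graph \<Lambda> v) (\<eta>, \<mu>) = (rng \<Lambda> (cmp \<Lambda> \<eta> \<mu>), cmp \<Lambda> \<eta> \<mu>)"
  "cmp (path_graph \<Lambda> v) (\<eta>, \<mu>) (\<eta>', \<mu>') = (cmp \<Lambda> \<eta> \<eta>', \<mu>')"
  "deg (path_graph \<Lambda> v) (\<eta>, \<mu>) = deg \<Lambda> \<eta>"
  by (simp_all add: path_graph_def)

lemma rng_cmp_absorb:
  "\<lbrakk>\<mu> \<in> mor \<Lambda>; \<nu> \<in> mor \<Lambda>; src \<Lambda> \<mu> = rng \<Lambda> \<nu>\<rbrakk>
    \<Longrightarrow> cmp \<Lambda> (rng \<Lambda> \<mu>) (cmp \<Lambda> \<mu> \<nu>) = cmp \<Lambda> \<mu> \<nu>"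
  using rng_cmp_id[OF cmp_mor] rng_cmp by metis

lemma cmp_rng: "\<lbrakk>\<mu> \<in> mor \<Lambda>; src \<Lambda> \<mu> = rng \<Lambda> \<nu>\<rbrakk> \<Longrightarrow> cmp \<Lambda> \<mu> (rng \<Lambda> \<nu>) = \<mu>"
  using cmp_src by metis

text \<open>Factorizations of \<open>(\<eta>, \<mu>)\<close> are those of \<open>\<eta>\<close>: once \<open>\<eta> = \<alpha>\<beta>\<close> is chosen, the second
  components are forced to be \<open>\<beta>\<mu>\<close> and \<open>\<mu>\<close>.  Having a k-graph again, the facts about segments
  apply to it.\<close>

lemma k_graph_path_graph: "k_graph k (path_graph \<Lambda> v)"
proof (unfold_locales, goal_cases)
  case 1
  have "mor (path_graph \<Lambda> v) \<subseteq> mor \<Lambda> \<times> mor \<Lambda>" by (auto simp: path_graph_def)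
  then show ?case 
    by (rule countable_subset) (simp add: countable_mor)
next
  case (17 \<kappa> m n)
  obtain \<eta> \<mu> where k: "\<kappa> = (\<eta>, \<mu>)" by (cases \<kappa>)
  have e: "\<eta> \<in> mor \<Lambda>" "\<mu> \<in> mor \<Lambda>" "src \<Lambda> \<eta> = rng \<Lambda> \<mu>" "src \<Lambda> \<mu> = v" "deg \<Lambda> \<eta> = m + n"
    using 17 by (simp_all add: k)
  have "m \<le> deg \<Lambda> \<eta>" "deg \<Lambda> \<eta> - m = n" by (simp_all add: e(5) le_fun_def fun_eq_iff)
  then obtain \<alpha> \<beta> where ab: "\<alpha> \<in> mor \<Lambda>" "\<beta> \<in> mor \<Lambda>" "src \<Lambda> \<alpha> = rng \<Lambda> \<beta>"
      "deg \<Lambda> \<alpha> = m" "deg \<Lambda> \<beta> = n" "\<eta> = cmp \<Lambda> \<alpha> \<beta>"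
    using factorE[OF e(1)] by metis
  have sb: "src \<Lambda> \<beta> = rng \<Lambda> \<mu>" using e ab src_cmp by metis
  show ?case
  proof (rule ex1I[of _ "((\<alpha>, cmp \<Lambda> \<beta> \<mu>), (\<beta>, \<mu>))"], goal_cases)
    case 1
    then show ?case using e ab sb by (simp add: k cmp_mor rng_cmp src_cmp)
  next
    case (2 x)
    obtain \<alpha>' \<rho> \<beta>' \<mu>' where x: "x = ((\<alpha>', \<rho>), (\<beta>', \<mu>'))" by (metis surj_pair)
    have y: "\<alpha>' \<in> mor \<Lambda>" "\<beta>' \<in> mor \<Lambda>" "\<mu>' \<in> mor \<Lambda>" "src \<Lambda> \<alpha>' = rng \<Lambda> \<rho>" "\<rho> = cmp \<Lambda> \<beta>' \<mu>'"
      "src \<Lambda> \<beta>' = rng \<Lambda> \<mu>'" "deg \<Lambda> \<alpha>' = m" "\<eta> = cmp \<Lambda> \<alpha>' \<beta>'" "\<mu>' = \<mu>"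
      using 2 by (simp_all add: x k)
    have "src \<Lambda> \<alpha>' = rng \<Lambda> \<beta>'" using y rng_cmp by metis
    then have "\<alpha>' = \<alpha> \<and> \<beta>' = \<beta>"
      using factorization_unique[of \<alpha>' \<beta>' \<alpha> \<beta>] y ab by metis
    then show ?case using y by (simp add: x)
  qed
next
  case (2 \<kappa>)
  then show ?case by (cases \<kappa>) (simp add: src_mor rng_mor src_src rng_src src_rng rng_rng cmp_mor src_cmp rng_cmp cmp_src rng_cmp_id deg_Nk deg_rng deg_cmp rng_cmp_absorb)
next
  case (3 \<kappa>)
  then show ?case by (cases \<kappa>) (simp add: src_mor rng_mor src_src rng_src src_rng rng_rng cmp_mor src_cmp rng_cmp cmp_src rng_cmp_id deg_Nk deg_rng deg_cmp rng_cmp_absorb)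
next
  case (4 \<kappa>)
  then show ?case by (cases \<kappa>) (simp add: src_mor rng_mor src_src rng_src src_rng rng_rng cmp_mor src_cmp rng_cmp cmp_src rng_cmp_id deg_Nk deg_rng deg_cmp rng_cmp_absorb)
next
  case (5 \<kappa>)
  then show ?case by (cases \<kappa>) (simp add: src_mor rng_mor src_src rng_src src_rng rng_rng cmp_mor src_cmp rng_cmp cmp_src rng_cmp_id deg_Nk deg_rng deg_cmp rng_cmp_absorb)
next
  case (6 \<kappa>)
  then show ?case by (cases \<kappa>) (simp add: src_mor rng_mor src_src rng_src src_rng rng_rng cmp_mor src_cmp rng_cmp cmp_src rng_cmp_id deg_Nk deg_rng deg_cmp rng_cmp_absorb)
next
  case (7 \<kappa>)
  then show ?case by (cases \<kappa>) (simp add: src_mor rng_mor src_src rng_src src_rng rng_rng cmp_mor src_cmp rng_cmp cmp_src rng_cmp_id deg_Nk deg_rng deg_cmp rng_cmp_absorb)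
next
  case (8 \<mu> \<nu>)
  then show ?case by (cases \<mu>; cases \<nu>) (simp add: src_mor rng_mor src_src rng_src src_rng rng_rng cmp_mor src_cmp rng_cmp cmp_src rng_cmp_id deg_Nk deg_rng deg_cmp rng_cmp_absorb)
next
  case (9 \<mu> \<nu>)
  then show ?case by (cases \<mu>; cases \<nu>) (simp add: src_mor rng_mor src_src rng_src src_rng rng_rng cmp_mor src_cmp rng_cmp cmp_src rng_cmp_id deg_Nk deg_rng deg_cmp rng_cmp_absorb)
next
  case (10 \<mu> \<nu>)
  then show ?case by (cases \<mu>; cases \<nu>) (simp add: src_mor rng_mor src_src rng_src src_rng rng_rng cmp_mor src_cmp rng_cmp cmp_src rng_cmp_id deg_Nk deg_rng deg_cmp cmp_assoc)
next
  case (11 \<kappa>)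
  then show ?case by (cases \<kappa>) (simp add: src_mor rng_mor src_src rng_src src_rng rng_rng cmp_mor src_cmp rng_cmp cmp_src rng_cmp_id deg_Nk deg_rng deg_cmp cmp_rng)
next
  case (12 \<kappa>)
  then show ?case by (cases \<kappa>) (simp add: src_mor rng_mor src_src rng_src src_rng rng_rng cmp_mor src_cmp rng_cmp cmp_src rng_cmp_id deg_Nk deg_rng deg_cmp rng_cmp_absorb)
next
  case (13 \<kappa> \<mu> \<nu>)
  then show ?case by (cases \<kappa>; cases \<mu>; cases \<nu>) (simp add: src_mor rng_mor src_src rng_src src_rng rng_rng cmp_mor src_cmp rng_cmp cmp_src rng_cmp_id deg_Nk deg_rng deg_cmp cmp_assoc)
next
  case (14 \<kappa>)
  then show ?case by (cases \<kappa>) (simp add: src_mor rng_mor src_src rng_src src_rng rng_rng cmp_mor src_cmp rng_cmp cmp_src rng_cmp_id deg_Nk deg_rng deg_cmp rng_cmp_absorb)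
next
  case (15 \<kappa>)
  then show ?case by (cases \<kappa>) (simp add: src_mor rng_mor src_src rng_src src_rng rng_rng cmp_mor src_cmp rng_cmp cmp_src rng_cmp_id deg_Nk deg_rng deg_cmp rng_cmp_absorb)
next
  case (16 \<mu> \<nu>)
  then show ?case by (cases \<mu>; cases \<nu>) (simp add: src_mor rng_mor src_src rng_src src_rng rng_rng cmp_mor src_cmp rng_cmp cmp_src rng_cmp_id deg_Nk deg_rng deg_cmp rng_cmp_absorb)
qed

text \<open>Both components on the right depend on \<open>b + p\<close> and \<open>b + q\<close> only, so subcubes of different
  pairs \<open>(\<lambda>(b,c), \<lambda>(c,d(\<lambda>)))\<close> of the same \<open>\<lambda>\<close> can be compared.\<close>

lemma seg_path_graph:
  assumes "\<kappa> \<in> mor \<Lambda>" "src \<Lambda> \<kappa> = v" "b \<le> c" "c \<le> deg \<Lambda> \<kappa>" "p \<le> q" "q \<le> c - b"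
  shows "seg (path_graph \<Lambda> v) (seg \<Lambda> \<kappa> b c, seg \<Lambda> \<kappa> c (deg \<Lambda> \<kappa>)) p q =
    (seg \<Lambda> \<kappa> (b + p) (b + q), seg \<Lambda> \<kappa> (b + q) (deg \<Lambda> \<kappa>))"
proof -
  interpret path: k_graph k "path_graph \<Lambda> v" by (rule k_graph_path_graph)
  have 1: "b \<le> b + p" "b + p \<le> b + q" using assms(5) by (simp_all add: le_fun_def)
  have 2: "b + q \<le> c" using assms(3,6) fun_add_le_iff by blast
  have o: "b \<le> b + p" "b + p \<le> b + q" "b + q \<le> c" "b + p \<le> c" "b + q \<le> deg \<Lambda> \<kappa>" "b + p \<le> deg \<Lambda> \<kappa>"
    using 1 2 assms(4) order_trans by metis+
  show ?thesis
  proof (rule path.seg_eqI[of "(seg \<Lambda> \<kappa> b (b + p), seg \<Lambda> \<kappa> (b + p) (deg \<Lambda> \<kappa>))" _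
        "(seg \<Lambda> \<kappa> (b + q) c, seg \<Lambda> \<kappa> c (deg \<Lambda> \<kappa>))"])
    show "deg (path_graph \<Lambda> v) (seg \<Lambda> \<kappa> b (b + p), seg \<Lambda> \<kappa> (b + p) (deg \<Lambda> \<kappa>)) = p"
      using assms o by (simp add: deg_seg fun_eq_iff)
    show "deg (path_graph \<Lambda> v) (seg \<Lambda> \<kappa> b (b + p), seg \<Lambda> \<kappa> (b + p) (deg \<Lambda> \<kappa>)) +
        deg (path_graph \<Lambda> v) (seg \<Lambda> \<kappa> (b + p) (b + q), seg \<Lambda> \<kappa> (b + q) (deg \<Lambda> \<kappa>)) = q"
      using assms o by (simp add: deg_seg fun_eq_iff le_fun_def)
  qed (use assms o in \<open>simp_all add: seg_mor seg_deg_deg rng_seg src_seg cmp_seg_seg\<close>)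
qed

end

section \<open>Boxes of positions\<close>

text \<open>A grid position of a cube of colour set \<open>K\<close> is free in the directions in \<open>K\<close>, where it
  ranges over a half-open interval, and pinned in all others.\<close>

definition box :: "(nat \<Rightarrow> nat) \<Rightarrow> (nat \<Rightarrow> nat) \<Rightarrow> nat set \<Rightarrow> (nat \<Rightarrow> nat) set" where
  "box lo hi K = {m. \<forall>j. if j \<in> K then lo j \<le> m j \<and> m j < hi j else m j = lo j}"

lemma box_cong: "(\<And>j. lo j = lo' j) \<Longrightarrow> (\<And>j. j \<in> K \<Longrightarrow> hi j = hi' j) \<Longrightarrow> box lo hi K = box lo' hi' K"
  unfolding box_def by (intro Collect_cong all_cong1) auto

lemma bij_betw_box:
  assumes "c \<in> K"
  shows "bij_betw (\<lambda>(m, x). m(c := x)) (box lo hi (K - {c}) \<times> {lo c..<hi c}) (box lo hi K)"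
  by (rule bij_betw_byWitness[of _ "\<lambda>m. (m(c := lo c), m c)"])
    (use assms in \<open>auto simp: box_def fun_eq_iff split: if_splits\<close>)

lemma sum_box_fiber:
  assumes "c \<in> K"
  shows "sum g (box lo hi K) = (\<Sum>m\<in>box lo hi (K - {c}). \<Sum>x = lo c..<hi c. g (m(c := x)))"
proof -
  have "sum g (box lo hi K) = (\<Sum>(m, x)\<in>box lo hi (K - {c}) \<times> {lo c..<hi c}. g (m(c := x)))"
    using sum.reindex_bij_betw[OF bij_betw_box[OF assms], of g lo hi] by (simp add: case_prod_unfold)
  then show ?thesis by (simp add: sum.cartesian_product)
qed

lemma finite_box: "finite K \<Longrightarrow> finite (box lo hi K)"
proof (induction K rule: finite_induct)
  case empty
  have "box lo hi {} \<subseteq> {lo}" by (auto simp: box_def fun_eq_iff)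
  then show ?case using finite_subset by blast
next
  case (insert c K)
  then have "finite (box lo hi (insert c K - {c}) \<times> {lo c..<hi c})" by simp
  then show ?case using bij_betw_finite[OF bij_betw_box[of c "insert c K"]] by blast
qed

text \<open>Differences in a free direction telescope, leaving the two opposite walls of the box.\<close>

lemma sum_box_difference:
  fixes g :: "(nat \<Rightarrow> nat) \<Rightarrow> 'b::ab_group_add"
  assumes "c \<in> K" "lo c \<le> hi c"
  shows "(\<Sum>m\<in>box lo hi K. g m - g (m + unit_deg c)) =
    sum g (box lo hi (K - {c})) - sum g (box (lo(c := hi c)) hi (K - {c}))"
proof -
  have step: "m(c := x) + unit_deg c = m(c := Suc x)" for m :: "nat \<Rightarrow> nat" and x
    by (auto simp: unit_deg_def fun_eq_iff)
  have "(\<Sum>m\<in>box lo hi K. g m - g (m + unit_deg c)) =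
      (\<Sum>m\<in>box lo hi (K - {c}). \<Sum>x = lo c..<hi c. g (m(c := x)) - g (m(c := Suc x)))"
    by (simp add: sum_box_fiber[OF assms(1)] step)
  also have "\<dots> = (\<Sum>m\<in>box lo hi (K - {c}). g m - g (m(c := hi c)))"
  proof (rule sum.cong[OF refl])
    fix m assume "m \<in> box lo hi (K - {c})"
    then have "m c = lo c" by (auto simp: box_def)
    then have "m(c := lo c) = m" by auto
    then show "(\<Sum>x = lo c..<hi c. g (m(c := x)) - g (m(c := Suc x))) = g m - g (m(c := hi c))"
      using sum_Suc_diff'[OF assms(2), of "\<lambda>x. - g (m(c := x))"] by simp
  qed
  also have "\<dots> = sum g (box lo hi (K - {c})) - (\<Sum>m\<in>box lo hi (K - {c}). g (m(c := hi c)))"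
    by (rule sum_subtractf)
  also have "(\<Sum>m\<in>box lo hi (K - {c}). g (m(c := hi c))) = sum g (box (lo(c := hi c)) hi (K - {c}))"
    by (rule sum.reindex_bij_witness[of _ "\<lambda>m. m(c := lo c)" "\<lambda>m. m(c := hi c)"])
      (auto simp: box_def fun_eq_iff split: if_splits)
  finally show ?thesis .
qed

text \<open>Cutting one free interval in two; merging neighbours in a tuple does this in reverse.\<close>

lemma sum_box_split:
  fixes g :: "(nat \<Rightarrow> nat) \<Rightarrow> 'b::comm_monoid_add"
  assumes "c \<in> K" "lo c \<le> x" "x \<le> hi c" "finite K"
  shows "sum g (box lo hi K) = sum g (box (lo(c := x)) hi K) + sum g (box lo (hi(c := x)) K)"
proof -
  have "box lo hi K = box (lo(c := x)) hi K \<union> box lo (hi(c := x)) K"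
  proof (intro Set.set_eqI iffI)
    fix m assume m: "m \<in> box lo hi K"
    show "m \<in> box (lo(c := x)) hi K \<union> box lo (hi(c := x)) K"
      using m assms(1) by (cases "m c < x") (auto simp: box_def)
  next
    fix m assume m: "m \<in> box (lo(c := x)) hi K \<union> box lo (hi(c := x)) K"
    show "m \<in> box lo hi K" unfolding box_def
    proof (intro CollectI allI)
      fix j
      show "if j \<in> K then lo j \<le> m j \<and> m j < hi j else m j = lo j"
        using m assms by (cases "j = c") (auto simp: box_def split: if_splits dest!: spec[of _ j])
    qed
  qed
  moreover have "m c < x" if "m \<in> box lo (hi(c := x)) K" for m
    using that assms(1) by (auto simp: box_def dest!: spec[of _ c])
  moreover have "x \<le> m c" if "m \<in> box (lo(c := x)) hi K" for m
    using that assms(1) by (auto simp: box_def dest!: spec[of _ c])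
  ultimately show ?thesis
    using assms(4) by (subst sum.union_disjoint[symmetric]) (auto simp: finite_box, meson not_le)
qed

section \<open>Ranks and the alternating sum\<close>

text \<open>The number \<open>r\<^sub>K(j)\<close> replaces the enumeration \<open>K\<^sub>(\<^sub>1\<^sub>) < K\<^sub>(\<^sub>2\<^sub>) < \<dots>\<close>: it is defined for every
  colour \<open>j\<close> and changes in a simple way when an element of \<open>K\<close> is removed.\<close>

definition rank :: "nat set \<Rightarrow> nat \<Rightarrow> nat" where
  "rank K j = card (K \<inter> {..<j})"

lemma rank_insert: "finite L \<Longrightarrow> c \<notin> L \<Longrightarrow> rank (insert c L) j = rank L j + of_bool (c < j)"
  by (simp add: rank_def)

lemma rank_Suc: "finite L \<Longrightarrow> rank L (Suc c) = rank L c + of_bool (c \<in> L)"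
  by (simp add: rank_def lessThan_Suc)

lemma rank_mono: "finite L \<Longrightarrow> i \<le> j \<Longrightarrow> rank L i \<le> rank L j"
  unfolding rank_def by (intro card_mono) auto

lemma rank_less: "finite L \<Longrightarrow> i \<in> L \<Longrightarrow> i < j \<Longrightarrow> rank L i < rank L j"
  using rank_mono[of L "Suc i" j] rank_Suc[of L i] by simp

lemma rank_less_card: "finite L \<Longrightarrow> i \<in> L \<Longrightarrow> rank L i < card L"
  unfolding rank_def by (intro psubset_card_mono) auto

lemma rank_le_card: "finite K \<Longrightarrow> rank K j \<le> card K"
  unfolding rank_def by (intro card_mono) auto

lemma rank_eq_card: "K \<subseteq> {..<j} \<Longrightarrow> rank K j = card K"
  by (simp add: rank_def Int_absorb2)

lemma nth_smallest_mem:
  assumes "finite K" "i \<in> {1..card K}"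
  shows "nth_smallest K i \<in> K"
proof -
  have "nth_smallest K i \<in> set (sorted_list_of_set K)"
    unfolding nth_smallest_def using assms by (intro nth_mem) auto
  then show ?thesis using assms by simp
qed

lemma nth_smallest_less:
  assumes "finite K" "1 \<le> i" "i < i'" "i' \<le> card K"
  shows "nth_smallest K i < nth_smallest K i'"
  unfolding nth_smallest_def
  by (rule sorted_wrt_nth_less[OF strict_sorted_list_of_set]) (use assms in simp_all)

lemma bij_betw_nth_smallest:
  assumes "finite K"
  shows "bij_betw (nth_smallest K) {1..card K} K"
proof -
  have "inj_on (nth_smallest K) {1..card K}"
    using nth_smallest_less[OF assms] by (intro linorder_inj_onI) (auto simp: less_imp_neq)
  moreover have "nth_smallest K ` {1..card K} \<subseteq> K" using nth_smallest_mem[OF assms] by blast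
  ultimately show ?thesis
    using assms by (simp add: bij_betw_def card_image card_subset_eq)
qed

lemma rank_nth_smallest:
  assumes "finite K" "i \<in> {1..card K}"
  shows "rank K (nth_smallest K i) = i - 1"
proof -
  have "K \<inter> {..<nth_smallest K i} = nth_smallest K ` {1..<i}"
  proof (intro Set.set_eqI iffI)
    fix x assume x: "x \<in> K \<inter> {..<nth_smallest K i}"
    then have "x \<in> nth_smallest K ` {1..card K}"
      using bij_betw_imp_surj_on[OF bij_betw_nth_smallest[OF assms(1)]] by simp
    then obtain i' where i': "i' \<in> {1..card K}" "x = nth_smallest K i'" by blast
    have "i' < i"
    proof (rule ccontr)
      assume "\<not> i' < i"
      then have "i = i' \<or> i < i'" by linarith
      then have "nth_smallest K i \<le> x"
        using nth_smallest_less[OF assms(1), of i i'] i' assms(2) by fastforce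
      then show False using x by simp
    qed
    then show "x \<in> nth_smallest K ` {1..<i}" using i' by auto
  next
    fix x assume "x \<in> nth_smallest K ` {1..<i}"
    then obtain i' where i': "i' \<in> {1..<i}" "x = nth_smallest K i'" by blast
    then have "x \<in> K" "x < nth_smallest K i"
      using nth_smallest_mem[OF assms(1), of i'] nth_smallest_less[OF assms(1), of i' i] assms(2)
      by simp_all
    then show "x \<in> K \<inter> {..<nth_smallest K i}" by simp
  qed
  moreover have "inj_on (nth_smallest K) {1..<i}"
    by (rule inj_on_subset[OF bij_betw_imp_inj_on[OF bij_betw_nth_smallest[OF assms(1)]]])
      (use assms(2) in auto)
  ultimately show ?thesis by (simp add: rank_def card_image)
qed

lemma sum_over_ranks:
  assumes "finite K"
  shows "(\<Sum>c\<in>K. f (rank K c) c) = (\<Sum>i = 1..card K. f (i - 1) (nth_smallest K i))"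
  using sum.reindex_bij_betw[OF bij_betw_nth_smallest[OF assms], of "\<lambda>c. f (rank K c) c"]
  by (simp add: rank_nth_smallest[OF assms])

text \<open>The Galois connection that turns the cutoffs \<open>j > K\<^sub>(\<^sub>i\<^sub>)\<close> in the definition of \<open>square_hat\<close> into
  bounds \<open>i \<le> r\<^sub>K(j)\<close> on the number of factors that contribute to colour \<open>j\<close>.\<close>

lemma nth_smallest_less_iff:
  assumes "finite K" "i \<in> {1..card K}"
  shows "nth_smallest K i < j \<longleftrightarrow> i \<le> rank K j"
proof
  assume "nth_smallest K i < j"
  then have "rank K (nth_smallest K i) < rank K j"
    by (rule rank_less[OF assms(1) nth_smallest_mem[OF assms]])
  then show "i \<le> rank K j" using assms by (simp add: rank_nth_smallest)
next
  assume i: "i \<le> rank K j"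
  show "nth_smallest K i < j"
  proof (rule ccontr)
    assume "\<not> nth_smallest K i < j"
    then have "rank K j \<le> rank K (nth_smallest K i)" using rank_mono assms(1) by simp
    moreover have "0 < i" using assms(2) by simp
    ultimately show False using i rank_nth_smallest[OF assms] by linarith
  qed
qed

text \<open>With \<open>T(c)\<close> the product of \<open>S(c)\<close> with \<open>(-1)\<close> to the power \<open>r\<^sub>L(c)\<close>, each \<open>T(c) - T(c + 1)\<close> is a
  difference of two values of \<open>S\<close> if \<open>c\<close> is outside \<open>L\<close> and a sum of two if \<open>c\<close> is in \<open>L\<close>, because
  \<open>r\<^sub>L\<close> jumps exactly after the elements of \<open>L\<close>.  The sum over all colours telescopes.\<close>

lemma alternating_telescope:
  fixes S :: "nat \<Rightarrow> 'c \<Rightarrow>\<^sub>0 int"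
  assumes "L \<subseteq> {1..k}"
  shows "(\<Sum>c\<in>{1..k} - L. frag_cmul ((-1) ^ (rank L c + 1)) (S (c + 1) - S c)) =
    S 1 + (\<Sum>c\<in>L. frag_cmul ((-1) ^ (rank L c + 1)) (S c + S (c + 1)))
      + frag_cmul ((-1) ^ (card L + 1)) (S (k + 1))"
proof -
  have fin: "finite L" using assms finite_subset by blast
  let ?T = "\<lambda>c. frag_cmul ((-1) ^ rank L c) (S c)"
  have out: "frag_cmul ((-1) ^ (rank L c + 1)) (S (c + 1) - S c) = ?T c - ?T (c + 1)" if "c \<notin> L" for c
    using that fin by (intro poly_mapping_eqI) (simp add: rank_Suc lookup_minus lookup_add algebra_simps)
  have "in": "frag_cmul ((-1) ^ (rank L c + 1)) (S c + S (c + 1)) = - (?T c - ?T (c + 1))" if "c \<in> L" for c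
    using that fin by (intro poly_mapping_eqI) (simp add: rank_Suc lookup_minus lookup_add algebra_simps)
  have "(\<Sum>c = 1..k. ?T c - ?T (c + 1)) = ?T 1 - ?T (k + 1)"
    using sum_Suc_diff[of 1 k "\<lambda>c. - ?T c"] by (simp del: minus_frag_cmul)
  moreover have "(\<Sum>c = 1..k. ?T c - ?T (c + 1)) =
      (\<Sum>c\<in>{1..k} - L. ?T c - ?T (c + 1)) + (\<Sum>c\<in>L. ?T c - ?T (c + 1))"
    by (rule sum.subset_diff) (use assms in auto)
  moreover have "rank L 1 = 0" using assms by (auto simp: rank_def)
  moreover have "rank L (k + 1) = card L" using assms by (intro rank_eq_card) auto
  ultimately have tel: "(\<Sum>c\<in>{1..k} - L. ?T c - ?T (c + 1)) =
      S 1 - frag_cmul ((-1) ^ card L) (S (k + 1)) - (\<Sum>c\<in>L. ?T c - ?T (c + 1))"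
    by (simp add: algebra_simps)
  have A: "(\<Sum>c\<in>{1..k} - L. frag_cmul ((-1) ^ (rank L c + 1)) (S (c + 1) - S c)) =
      (\<Sum>c\<in>{1..k} - L. ?T c - ?T (c + 1))"
    by (rule sum.cong[OF refl], rule out) simp
  have B: "(\<Sum>c\<in>L. frag_cmul ((-1) ^ (rank L c + 1)) (S c + S (c + 1))) = - (\<Sum>c\<in>L. ?T c - ?T (c + 1))"
    unfolding sum_negf[symmetric] by (rule sum.cong[OF refl], rule "in")
  show ?thesis unfolding A B tel by simp
qed

section \<open>Boxes cut out by a chain of degrees\<close>

text \<open>Stage \<open>q\<close> of the chain \<open>D\<close> is the step from \<open>D\<^sub>q\<close> to \<open>D\<^sub>q\<^sub>+\<^sub>1\<close>, which for a tuple is the contribution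
  of its entry of index \<open>q\<close>; \<open>r\<close> selects for each colour the stage whose interval is used.\<close>

definition stage_box :: "(nat \<Rightarrow> nat \<Rightarrow> nat) \<Rightarrow> (nat \<Rightarrow> nat) \<Rightarrow> nat set \<Rightarrow> (nat \<Rightarrow> nat) set" where
  "stage_box D r K = box (\<lambda>j. D (r j) j) (\<lambda>j. D (Suc (r j)) j) K"

lemma finite_stage_box: "finite K \<Longrightarrow> finite (stage_box D r K)"
  by (simp add: stage_box_def finite_box)

text \<open>Composing a sequence with \<open>skip i\<close> omits its term of index \<open>i\<close>.\<close>

definition skip :: "nat \<Rightarrow> nat \<Rightarrow> nat" where
  "skip i q = (if q < i then q else Suc q)"

text \<open>The wall \<open>m\<^sub>c = D\<^sub>q(c)\<close>, where \<open>q\<close> is the rank of \<open>c\<close>, uses stage \<open>q\<close> for \<open>c\<close>; the opposite wall uses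
  stage \<open>q + 1\<close>, like the colours above \<open>c\<close>.  This is why the threshold for the raised stage is
  \<open>c + 1\<close> for one wall and \<open>c\<close> for the other.\<close>

lemma sum_stage_box_difference:
  fixes g :: "(nat \<Rightarrow> nat) \<Rightarrow> 'b::ab_group_add"
  assumes "finite L" "c \<notin> L" and mono: "\<And>q j. D q j \<le> D (Suc q) j"
  shows "(\<Sum>m\<in>stage_box D (rank (insert c L)) (insert c L). g m - g (m + unit_deg c)) =
    sum g (stage_box D (\<lambda>j. rank L j + of_bool (c + 1 \<le> j)) L) -
    sum g (stage_box D (\<lambda>j. rank L j + of_bool (c \<le> j)) L)"
proof -
  let ?r = "\<lambda>j. rank L j + of_bool (c < j)"
  let ?lo = "\<lambda>j. D (?r j) j" and ?hi = "\<lambda>j. D (Suc (?r j)) j"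
  have r: "rank (insert c L) = ?r" using assms by (simp add: rank_insert fun_eq_iff)
  have "(\<Sum>m\<in>stage_box D (rank (insert c L)) (insert c L). g m - g (m + unit_deg c)) =
      sum g (box ?lo ?hi L) - sum g (box (?lo(c := ?hi c)) ?hi L)"
    unfolding stage_box_def r
    using sum_box_difference[of c "insert c L" ?lo ?hi g] mono assms(2) by simp
  moreover have "box ?lo ?hi L = stage_box D (\<lambda>j. rank L j + of_bool (c + 1 \<le> j)) L"
    by (simp add: stage_box_def less_eq_Suc_le)
  moreover have "box (?lo(c := ?hi c)) ?hi L = stage_box D (\<lambda>j. rank L j + of_bool (c \<le> j)) L"
    unfolding stage_box_def using assms(2) by (intro box_cong) (auto simp: le_less)
  ultimately show ?thesis by simp
qed

text \<open>Omitting the breakpoint \<open>D\<^sub>q\<close>, where \<open>q\<close> is one more than the rank of \<open>c\<close>, joins the two intervals of \<open>c\<close>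
  that meet there.  Colours below \<open>c\<close> use stages before the breakpoint, and those above \<open>c\<close> stages
  after it, whence their shift by one.\<close>

lemma sum_stage_box_skip:
  fixes g :: "(nat \<Rightarrow> nat) \<Rightarrow> 'b::comm_monoid_add"
  assumes "finite L" "c \<in> L" and mono: "\<And>q j. D q j \<le> D (Suc q) j"
  shows "sum g (stage_box (D \<circ> skip (rank L c + 1)) (rank L) L) =
    sum g (stage_box D (\<lambda>j. rank L j + of_bool (c \<le> j)) L) +
    sum g (stage_box D (\<lambda>j. rank L j + of_bool (c + 1 \<le> j)) L)"
proof -
  let ?E = "D \<circ> skip (rank L c + 1)"
  let ?lo = "\<lambda>j. ?E (rank L j) j" and ?hi = "\<lambda>j. ?E (Suc (rank L j)) j"
  let ?x = "D (Suc (rank L c)) c"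
  have before: "rank L j \<le> rank L c" if "j \<le> c" for j using rank_mono assms(1) that by blast
  have before': "rank L j < rank L c" if "j < c" "j \<in> L" for j using rank_less assms(1) that by blast
  have after: "rank L c < rank L j" if "c < j" for j using rank_less assms(1,2) that by blast
  have "sum g (box ?lo ?hi L) = sum g (box (?lo(c := ?x)) ?hi L) + sum g (box ?lo (?hi(c := ?x)) L)"
    by (rule sum_box_split) (use assms mono in \<open>simp_all add: skip_def\<close>)
  moreover have "box (?lo(c := ?x)) ?hi L = stage_box D (\<lambda>j. rank L j + of_bool (c \<le> j)) L"
    unfolding stage_box_def
  proof (rule box_cong)
    fix j
    show "(?lo(c := ?x)) j = D (rank L j + of_bool (c \<le> j)) j"
      using before[of j] after[of j] by (cases j c rule: linorder_cases) (simp_all add: skip_def)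
    assume "j \<in> L"
    then show "?hi j = D (Suc (rank L j + of_bool (c \<le> j))) j"
      using before'[of j] after[of j] by (cases j c rule: linorder_cases) (simp_all add: skip_def)
  qed
  moreover have "box ?lo (?hi(c := ?x)) L = stage_box D (\<lambda>j. rank L j + of_bool (c + 1 \<le> j)) L"
    unfolding stage_box_def
  proof (rule box_cong)
    fix j
    show "?lo j = D (rank L j + of_bool (c + 1 \<le> j)) j"
      using before[of j] after[of j] by (cases j c rule: linorder_cases) (simp_all add: skip_def)
    assume "j \<in> L"
    then show "(?hi(c := ?x)) j = D (Suc (rank L j + of_bool (c + 1 \<le> j))) j"
      using before'[of j] after[of j] by (cases j c rule: linorder_cases) (simp_all add: skip_def)
  qed
  ultimately show ?thesis by (simp add: stage_box_def)
qed

section \<open>Cubes in a morphism and their faces\<close>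

lemma eK_apply: "finite K \<Longrightarrow> eK K j = of_bool (j \<in> K)"
  unfolding eK_def by (induction K rule: finite_induct) (auto simp: unit_deg_def)

definition cube :: "'a kgraph \<Rightarrow> 'a \<Rightarrow> (nat \<Rightarrow> nat) \<Rightarrow> nat set \<Rightarrow> 'a \<times> 'a" where
  "cube \<Lambda> \<kappa> m K = (seg \<Lambda> \<kappa> m (m + eK K), seg \<Lambda> \<kappa> (m + eK K) (deg \<Lambda> \<kappa>))"

abbreviation gen :: "'a kgraph \<Rightarrow> 'a \<Rightarrow> (nat \<Rightarrow> nat) \<Rightarrow> nat set \<Rightarrow> ('a \<times> 'a) option \<Rightarrow>\<^sub>0 int" where
  "gen \<Lambda> \<kappa> m K \<equiv> frag_of (Some (cube \<Lambda> \<kappa> m K))"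

context k_graph
begin

lemma cube_mor:
  assumes "\<kappa> \<in> mor \<Lambda>" "m + eK K \<le> deg \<Lambda> \<kappa>"
  shows "cube \<Lambda> \<kappa> m K \<in> mor (path_graph \<Lambda> (src \<Lambda> \<kappa>))"
    and deg_cube: "deg (path_graph \<Lambda> v) (cube \<Lambda> \<kappa> m K) = eK K"
proof -
  have "m \<le> m + eK K" by (simp add: le_fun_def)
  then show "cube \<Lambda> \<kappa> m K \<in> mor (path_graph \<Lambda> (src \<Lambda> \<kappa>))"
    "deg (path_graph \<Lambda> v) (cube \<Lambda> \<kappa> m K) = eK K"
    using assms by (simp_all add: cube_def seg_mor rng_seg src_seg seg_deg_deg deg_seg fun_eq_iff)
qed

lemma cube_in_cubes:
  assumes "\<kappa> \<in> mor \<Lambda>" "m + eK K \<le> deg \<Lambda> \<kappa>" "K \<subseteq> {1..k}"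
  shows "cube \<Lambda> \<kappa> m K \<in> cubes k (path_graph \<Lambda> (src \<Lambda> \<kappa>)) (card K)"
proof -
  have fin: "finite K" using assms(3) finite_subset by blast
  have "(\<Sum>i = 1..k. eK K i) = card ({1..k} \<inter> K)"
    by (simp add: eK_apply[OF fin])
  then show ?thesis
    using assms fin by (simp add: cubes_def cube_mor deg_cube eK_apply Int_absorb1)
qed

text \<open>The faces of a cube are numbered through its colour type, hence through \<open>K\<close>.\<close>

lemma color_type_cube:
  assumes "\<kappa> \<in> mor \<Lambda>" "m + eK K \<le> deg \<Lambda> \<kappa>" "K \<subseteq> {1..k}"
  shows "color_type k (path_graph \<Lambda> v) (cube \<Lambda> \<kappa> m K) = K"
proof -
  have "finite K" using assms(3) finite_subset by blast
  then show ?thesis using assms by (auto simp: color_type_def deg_cube eK_apply)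
qed

lemma face_cube:
  assumes "\<kappa> \<in> mor \<Lambda>" "m + eK K \<le> deg \<Lambda> \<kappa>" "K \<subseteq> {1..k}" "j \<in> {1..card K}"
  defines "c \<equiv> nth_smallest K j"
  shows "face k (path_graph \<Lambda> (src \<Lambda> \<kappa>)) 0 j (cube \<Lambda> \<kappa> m K) = cube \<Lambda> \<kappa> m (K - {c})"
    and "face k (path_graph \<Lambda> (src \<Lambda> \<kappa>)) 1 j (cube \<Lambda> \<kappa> m K) =
      cube \<Lambda> \<kappa> (m + unit_deg c) (K - {c})"
proof -
  have fin: "finite K" using assms(3) finite_subset by blast
  have c: "c \<in> K" unfolding c_def by (rule nth_smallest_mem[OF fin assms(4)])
  have e: "eK K - unit_deg c = eK (K - {c})"
    using c fin by (auto simp: fun_eq_iff eK_apply unit_deg_def)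
  have e': "m + unit_deg c + eK (K - {c}) = m + eK K"
    using c fin by (auto simp: fun_eq_iff eK_apply unit_deg_def)
  have le: "unit_deg c \<le> eK K" "0 \<le> eK (K - {c})" "eK (K - {c}) \<le> eK K"
    using c fin by (auto simp: le_fun_def eK_apply unit_deg_def)
  have d: "m + eK K - m = eK K" by (simp add: fun_eq_iff)
  have m: "m \<le> m + eK K" by (simp add: le_fun_def)
  note sub = seg_path_graph[OF assms(1) refl m assms(2), unfolded d, folded cube_def]
  show "face k (path_graph \<Lambda> (src \<Lambda> \<kappa>)) 0 j (cube \<Lambda> \<kappa> m K) = cube \<Lambda> \<kappa> m (K - {c})"
    using sub[OF le(2,3)] assms(1-3)
    by (simp add: face_def Let_def color_type_cube deg_cube e flip: c_def)
      (simp add: cube_def)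
  show "face k (path_graph \<Lambda> (src \<Lambda> \<kappa>)) 1 j (cube \<Lambda> \<kappa> m K) =
      cube \<Lambda> \<kappa> (m + unit_deg c) (K - {c})"
    using sub[OF le(1) order_refl] assms(1-3)
    by (simp add: face_def Let_def color_type_cube deg_cube flip: c_def)
      (simp add: cube_def e')
qed

lemma cube_boundary_gen:
  assumes "\<kappa> \<in> mor \<Lambda>" "m + eK K \<le> deg \<Lambda> \<kappa>" "K \<subseteq> {1..k}" "card K \<ge> 1"
  shows "cube_boundary k (path_graph \<Lambda> (src \<Lambda> \<kappa>)) (int (card K)) (gen \<Lambda> \<kappa> m K) =
    (\<Sum>c\<in>K. frag_cmul ((-1) ^ (rank K c + 1))
      (gen \<Lambda> \<kappa> m (K - {c}) - gen \<Lambda> \<kappa> (m + unit_deg c) (K - {c})))"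
proof -
  have fin: "finite K" using assms(3) finite_subset by blast
  have "cube_boundary k (path_graph \<Lambda> (src \<Lambda> \<kappa>)) (int (card K)) (gen \<Lambda> \<kappa> m K) =
    (\<Sum>j = 1..card K. \<Sum>l = 0..1. frag_cmul ((-1) ^ (j + l))
       (frag_of (Some (face k (path_graph \<Lambda> (src \<Lambda> \<kappa>)) l j (cube \<Lambda> \<kappa> m K)))))"
    using assms(4) by (simp add: cube_boundary_def)
  also have "\<dots> = (\<Sum>j = 1..card K. frag_cmul ((-1) ^ (j - 1 + 1))
      (gen \<Lambda> \<kappa> m (K - {nth_smallest K j}) -
       gen \<Lambda> \<kappa> (m + unit_deg (nth_smallest K j)) (K - {nth_smallest K j})))"
  proof (rule sum.cong[OF refl])
    fix j assume j: "j \<in> {1..card K}"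
    show "(\<Sum>l = 0..1. frag_cmul ((-1) ^ (j + l))
       (frag_of (Some (face k (path_graph \<Lambda> (src \<Lambda> \<kappa>)) l j (cube \<Lambda> \<kappa> m K))))) =
      frag_cmul ((-1) ^ (j - 1 + 1))
      (gen \<Lambda> \<kappa> m (K - {nth_smallest K j}) -
       gen \<Lambda> \<kappa> (m + unit_deg (nth_smallest K j)) (K - {nth_smallest K j}))"
    proof -
      have two: "{0..1::nat} = {0, 1}" by auto
      have "j - 1 + 1 = j" using j by simp
      then show ?thesis
        using face_cube[OF assms(1-3) j]
        by (intro poly_mapping_eqI) (simp add: two lookup_minus lookup_add right_diff_distrib)
    qed
  qed
  also have "\<dots> = (\<Sum>c\<in>K. frag_cmul ((-1) ^ (rank K c + 1))
      (gen \<Lambda> \<kappa> m (K - {c}) - gen \<Lambda> \<kappa> (m + unit_deg c) (K - {c})))"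
    by (rule sum_over_ranks[OF fin, symmetric])
  finally show ?thesis .
qed

text \<open>Prolonging \<open>\<beta>\<close> at its range moves the positions of its cubes, but not the cubes: in the path graph
  a cube remembers only itself and what follows it.\<close>

lemma cube_suffix:
  assumes "\<alpha> \<in> mor \<Lambda>" "\<beta> \<in> mor \<Lambda>" "src \<Lambda> \<alpha> = rng \<Lambda> \<beta>" "m + eK K \<le> deg \<Lambda> \<beta>"
  shows "cube \<Lambda> (cmp \<Lambda> \<alpha> \<beta>) (deg \<Lambda> \<alpha> + m) K = cube \<Lambda> \<beta> m K"
  using assms seg_suffix[OF assms(1-3), of m "m + eK K"] seg_suffix[OF assms(1-3) assms(4) order_refl]
  by (simp add: cube_def deg_cmp add.assoc le_fun_def)

lemma cube_prefix:
  assumes "\<alpha> \<in> mor \<Lambda>" "\<beta> \<in> mor \<Lambda>" "src \<Lambda> \<alpha> = rng \<Lambda> \<beta>" "m + eK K \<le> deg \<Lambda> \<alpha>"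
  shows "cube \<Lambda> (cmp \<Lambda> \<alpha> \<beta>) m K =
    (fst (cube \<Lambda> \<alpha> m K), cmp \<Lambda> (snd (cube \<Lambda> \<alpha> m K)) \<beta>)"
proof -
  let ?n = "m + eK K" and ?\<kappa> = "cmp \<Lambda> \<alpha> \<beta>"
  have k: "?\<kappa> \<in> mor \<Lambda>" "deg \<Lambda> ?\<kappa> = deg \<Lambda> \<alpha> + deg \<Lambda> \<beta>"
    using assms by (simp_all add: cmp_mor deg_cmp)
  have le: "m \<le> ?n" "deg \<Lambda> \<alpha> \<le> deg \<Lambda> ?\<kappa>" by (simp_all add: k le_fun_def)
  have "seg \<Lambda> ?\<kappa> (deg \<Lambda> \<alpha>) (deg \<Lambda> ?\<kappa>) = \<beta>"
    using seg_suffix[OF assms(1-3), of 0 "deg \<Lambda> \<beta>"] k assms(2) by (simp add: seg_full le_fun_def)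
  moreover have "seg \<Lambda> ?\<kappa> ?n (deg \<Lambda> \<alpha>) = seg \<Lambda> \<alpha> ?n (deg \<Lambda> \<alpha>)"
    using seg_prefix assms by simp
  ultimately have "seg \<Lambda> ?\<kappa> ?n (deg \<Lambda> ?\<kappa>) = cmp \<Lambda> (seg \<Lambda> \<alpha> ?n (deg \<Lambda> \<alpha>)) \<beta>"
    using cmp_seg_seg[OF k(1) assms(4) le(2) order_refl] by simp
  then show ?thesis using seg_prefix[OF assms(1-3) le(1) assms(4)] by (simp add: cube_def)
qed

end

section \<open>Composable tuples\<close>

text \<open>A recursive form of membership in \<open>tuples\<close>, following the recursion of \<open>composite\<close>.\<close>

fun composable :: "'a kgraph \<Rightarrow> 'a \<Rightarrow> 'a list \<Rightarrow> bool" where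
  "composable \<Lambda> v [] \<longleftrightarrow> False"
| "composable \<Lambda> v [x] \<longleftrightarrow> x \<in> mor \<Lambda> \<and> src \<Lambda> x = v"
| "composable \<Lambda> v (x # y # zs) \<longleftrightarrow> x \<in> mor \<Lambda> \<and> src \<Lambda> x = rng \<Lambda> y \<and> composable \<Lambda> v (y # zs)"

lemma composable_Cons:
  "ls \<noteq> [] \<Longrightarrow> composable \<Lambda> v (x # ls) \<longleftrightarrow> x \<in> mor \<Lambda> \<and> src \<Lambda> x = rng \<Lambda> (hd ls) \<and> composable \<Lambda> v ls"
  by (cases ls) auto

lemma composite_Cons: "ls \<noteq> [] \<Longrightarrow> composite \<Lambda> (x # ls) = cmp \<Lambda> x (composite \<Lambda> ls)"
  by (cases ls) auto

lemma composable_set: "composable \<Lambda> v ls \<Longrightarrow> set ls \<subseteq> mor \<Lambda>"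
  by (induction \<Lambda> v ls rule: composable.induct) auto

lemma composable_iff:
  "composable \<Lambda> v ls \<longleftrightarrow> ls \<noteq> [] \<and> set ls \<subseteq> mor \<Lambda> \<and>
     (\<forall>i\<in>{1..<length ls}. src \<Lambda> (ls ! (i - 1)) = rng \<Lambda> (ls ! i)) \<and> src \<Lambda> (last ls) = v"
proof (induction \<Lambda> v ls rule: composable.induct)
  case (3 \<Lambda> v x y zs)
  have "(\<forall>i\<in>{1..<length (x # y # zs)}. src \<Lambda> ((x # y # zs) ! (i - 1)) = rng \<Lambda> ((x # y # zs) ! i)) \<longleftrightarrow>
      src \<Lambda> x = rng \<Lambda> y \<and>
      (\<forall>i\<in>{1..<length (y # zs)}. src \<Lambda> ((y # zs) ! (i - 1)) = rng \<Lambda> ((y # zs) ! i))"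
    (is "(\<forall>i\<in>_. ?P i) \<longleftrightarrow> _ \<and> (\<forall>i\<in>_. ?Q i)")
  proof -
    let ?S = "{1..<length (y # zs)}"
    have split: "{1..<length (x # y # zs)} = insert 1 (Suc ` ?S)"
      by (auto simp: image_Suc_atLeastLessThan)
    have "(\<forall>i\<in>{1..<length (x # y # zs)}. ?P i) \<longleftrightarrow> ?P 1 \<and> (\<forall>i\<in>?S. ?P (Suc i))"
      unfolding split by blast
    moreover have "?P (Suc i) \<longleftrightarrow> ?Q i" if "i \<in> ?S" for i
      using that by (cases i) auto
    moreover have "?P 1 \<longleftrightarrow> src \<Lambda> x = rng \<Lambda> y" by simp
    ultimately show ?thesis by blast
  qed
  then show ?case using 3 by auto
qed auto

lemma tuples_iff: "ls \<in> tuples \<Lambda> n v \<longleftrightarrow> length ls = n \<and> composable \<Lambda> v ls"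
  by (auto simp: tuples_def composable_iff)

definition cumdeg :: "'a kgraph \<Rightarrow> 'a list \<Rightarrow> nat \<Rightarrow> nat \<Rightarrow> nat" where
  "cumdeg \<Lambda> ls q = sum_list (map (deg \<Lambda>) (take q ls))"

lemma cumdeg_Cons_Suc: "cumdeg \<Lambda> (x # ls) (Suc q) = deg \<Lambda> x + cumdeg \<Lambda> ls q"
  by (simp add: cumdeg_def)

lemma cumdeg_0 [simp]: "cumdeg \<Lambda> ls 0 = 0"
  by (simp add: cumdeg_def)

lemma cumdeg_Suc:
  "cumdeg \<Lambda> ls (Suc q) = cumdeg \<Lambda> ls q + (if q < length ls then deg \<Lambda> (ls ! q) else 0)"
  by (simp add: cumdeg_def take_Suc_conv_app_nth)

lemma cumdeg_Suc_mono: "cumdeg \<Lambda> ls q j \<le> cumdeg \<Lambda> ls (Suc q) j"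
  by (simp add: cumdeg_Suc)

lemma cumdeg_mono: "q \<le> q' \<Longrightarrow> cumdeg \<Lambda> ls q j \<le> cumdeg \<Lambda> ls q' j"
  by (rule lift_Suc_mono_le[of "\<lambda>q. cumdeg \<Lambda> ls q j"]) (rule cumdeg_Suc_mono)

lemma cumdeg_apply:
  "q \<le> length ls \<Longrightarrow> cumdeg \<Lambda> ls q p = (\<Sum>i = 1..q. deg \<Lambda> (ls ! (i - 1)) p)"
  by (induction q) (simp_all add: cumdeg_Suc)

context k_graph
begin

lemma cumdeg_outside:
  assumes "set ls \<subseteq> mor \<Lambda>" "j \<notin> {1..k}"
  shows "cumdeg \<Lambda> ls q j = 0"
proof (induction q)
  case (Suc q)
  have "deg \<Lambda> (ls ! q) j = 0" if "q < length ls"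
    using deg_Nk[of "ls ! q"] that assms nth_mem by (auto simp: Nk_def)
  then show ?case using Suc by (simp add: cumdeg_Suc)
qed simp

lemma composite_props:
  "composable \<Lambda> v ls \<Longrightarrow> composite \<Lambda> ls \<in> mor \<Lambda> \<and> src \<Lambda> (composite \<Lambda> ls) = v \<and>
    rng \<Lambda> (composite \<Lambda> ls) = rng \<Lambda> (hd ls) \<and> deg \<Lambda> (composite \<Lambda> ls) = cumdeg \<Lambda> ls (length ls)"
proof (induction ls)
  case (Cons x ls)
  show ?case
  proof (cases "ls = []")
    case True
    then show ?thesis using Cons by (simp add: cumdeg_Cons_Suc)
  next
    case False
    then show ?thesis using Cons
      by (simp add: composable_Cons composite_Cons cmp_mor src_cmp rng_cmp deg_cmp cumdeg_Cons_Suc)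
  qed
qed simp

text \<open>The equality of ranges is what lets the induction prepend a further entry.\<close>

lemma merge_append:
  "composable \<Lambda> v (us @ a # b # ws) \<Longrightarrow> composable \<Lambda> v (us @ cmp \<Lambda> a b # ws) \<and>
    composite \<Lambda> (us @ cmp \<Lambda> a b # ws) = composite \<Lambda> (us @ a # b # ws) \<and>
    rng \<Lambda> (hd (us @ cmp \<Lambda> a b # ws)) = rng \<Lambda> (hd (us @ a # b # ws))"
proof (induction us)
  case Nil
  show ?case
  proof (cases ws)
    case Nil
    with \<open>composable \<Lambda> v ([] @ a # b # ws)\<close> show ?thesis by (simp add: cmp_mor src_cmp rng_cmp)
  next
    case (Cons w ws')
    with \<open>composable \<Lambda> v ([] @ a # b # ws)\<close> show ?thesis
      using composite_props[of v "w # ws'"]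
      by (simp add: cmp_mor src_cmp rng_cmp cmp_assoc)
  qed
next
  case (Cons u us)
  then show ?case by (simp add: composable_Cons composite_Cons)
qed

text \<open>The merged tuple has the same partial products except the one that ends between \<open>a\<close> and \<open>b\<close>.\<close>

lemma cumdeg_merge_append:
  assumes "a \<in> mor \<Lambda>" "b \<in> mor \<Lambda>" "src \<Lambda> a = rng \<Lambda> b"
  shows "cumdeg \<Lambda> (us @ cmp \<Lambda> a b # ws) q = cumdeg \<Lambda> (us @ a # b # ws) (skip (length us + 1) q)"
proof (induction us arbitrary: q)
  case Nil
  then show ?case
    by (cases q) (simp_all add: skip_def cumdeg_Cons_Suc deg_cmp assms add.assoc)
next
  case (Cons u us)
  then show ?case
    by (cases q) (simp_all add: skip_def cumdeg_Cons_Suc)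
qed

lemma
  assumes "composable \<Lambda> v ls" "i \<in> {1..<length ls}"
  shows composable_merge: "composable \<Lambda> v (merge \<Lambda> i ls)"
    and composite_merge: "composite \<Lambda> (merge \<Lambda> i ls) = composite \<Lambda> ls"
    and cumdeg_merge: "cumdeg \<Lambda> (merge \<Lambda> i ls) = cumdeg \<Lambda> ls \<circ> skip i"
    and length_merge: "length (merge \<Lambda> i ls) = length ls - 1"
proof -
  define us a b ws where "us = take (i - 1) ls" and "a = ls ! (i - 1)" and "b = ls ! i"
    and "ws = drop (i + 1) ls"
  have len: "length us = i - 1" using assms(2) by (auto simp: us_def)
  have i: "Suc (i - 1) = i" using assms(2) by simp
  have "ls = us @ drop (i - 1) ls" by (simp add: us_def)
  also have "drop (i - 1) ls = a # drop i ls"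
    using Cons_nth_drop_Suc[of "i - 1" ls] assms(2) i by (simp add: a_def)
  also have "drop i ls = b # ws"
    using Cons_nth_drop_Suc[of i ls] assms(2) by (simp add: b_def ws_def)
  finally have ls: "ls = us @ a # b # ws" .
  have m: "merge \<Lambda> i ls = us @ cmp \<Lambda> a b # ws"
    by (simp add: merge_def us_def a_def b_def ws_def)
  have ab: "a \<in> mor \<Lambda>" "b \<in> mor \<Lambda>" "src \<Lambda> a = rng \<Lambda> b"
    using assms unfolding composable_iff a_def b_def by (auto simp: subset_iff)
  show "composable \<Lambda> v (merge \<Lambda> i ls)" "composite \<Lambda> (merge \<Lambda> i ls) = composite \<Lambda> ls"
    using merge_append[of v us a b ws] assms(1) ls m by simp_all
  have "length us + 1 = i" using len i by simp
  then show "cumdeg \<Lambda> (merge \<Lambda> i ls) = cumdeg \<Lambda> ls \<circ> skip i"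
    using cumdeg_merge_append[OF ab, of us ws] unfolding m by (simp add: fun_eq_iff flip: ls)
  show "length (merge \<Lambda> i ls) = length ls - 1"
    unfolding m by (subst ls) simp
qed

text \<open>As for merging, the equality of ranges carries the induction.\<close>

lemma extend_last:
  "composable \<Lambda> (rng \<Lambda> \<kappa>) ls \<Longrightarrow> \<kappa> \<in> mor \<Lambda> \<Longrightarrow>
    composable \<Lambda> (src \<Lambda> \<kappa>) (butlast ls @ [cmp \<Lambda> (last ls) \<kappa>]) \<and>
    composite \<Lambda> (butlast ls @ [cmp \<Lambda> (last ls) \<kappa>]) = cmp \<Lambda> (composite \<Lambda> ls) \<kappa> \<and>
    rng \<Lambda> (hd (butlast ls @ [cmp \<Lambda> (last ls) \<kappa>])) = rng \<Lambda> (hd ls)"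
proof (induction ls)
  case (Cons x ls)
  show ?case
  proof (cases "ls = []")
    case True
    then show ?thesis using Cons.prems by (simp add: cmp_mor src_cmp rng_cmp)
  next
    case False
    have "composable \<Lambda> (rng \<Lambda> \<kappa>) ls" using Cons.prems False by (simp add: composable_Cons)
    then show ?thesis using Cons False composite_props[of "rng \<Lambda> \<kappa>" ls]
      by (simp add: composable_Cons composite_Cons cmp_assoc)
  qed
qed simp

lemma cumdeg_extend_last:
  "q < length ls \<Longrightarrow> cumdeg \<Lambda> (butlast ls @ [x]) q = cumdeg \<Lambda> ls q"
  by (simp add: cumdeg_def take_butlast)

end

section \<open>The map to cubes as a sum over boxes\<close>

definition cube_sum ::
    "'a kgraph \<Rightarrow> 'a \<Rightarrow> (nat \<Rightarrow> nat \<Rightarrow> nat) \<Rightarrow> (nat \<Rightarrow> nat) \<Rightarrow> nat set \<Rightarrow> ('a \<times> 'a) option \<Rightarrow>\<^sub>0 int"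
  where "cube_sum \<Lambda> \<kappa> D r K = (\<Sum>m\<in>stage_box D r K. gen \<Lambda> \<kappa> m K)"

lemma stage_box_bound:
  assumes "m \<in> stage_box D r K" "finite K" "\<And>j. r j \<le> M" "\<And>j. j \<in> K \<Longrightarrow> r j < M"
    and mono: "\<And>q q' j. q \<le> q' \<Longrightarrow> D q j \<le> D q' j"
  shows "m + eK K \<le> D M"
proof (rule le_funI)
  fix j
  show "(m + eK K) j \<le> D M j"
  proof (cases "j \<in> K")
    case True
    then have "m j < D (Suc (r j)) j" using assms(1) by (auto simp: stage_box_def box_def)
    also have "\<dots> \<le> D M j" by (intro mono Suc_leI assms(4) True)
    finally show ?thesis using True assms(2) by (simp add: eK_apply)
  next
    case False
    then have "m j = D (r j) j" using assms(1) by (auto simp: stage_box_def box_def)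
    then show ?thesis using False assms(2,3) mono by (simp add: eK_apply)
  qed
qed

context k_graph
begin

text \<open>The corners in the definition of \<open>square_hat\<close> have this shape.  Their cutoffs \<open>t\<close> increase along \<open>K\<close>,
  so in colour \<open>p\<close> exactly some number \<open>q\<close> of first entries of the tuple contribute.\<close>

lemma sum_cutoff:
  assumes "set ls \<subseteq> mor \<Lambda>" "N \<le> length ls" "q \<le> N" "\<And>i. i \<in> {1..N} \<Longrightarrow> t i \<le> p \<longleftrightarrow> i \<le> q"
  shows "(\<Sum>i = 1..N. \<Sum>j = t i..k. deg \<Lambda> (ls ! (i - 1)) j * unit_deg j p) = cumdeg \<Lambda> ls q p"
proof -
  have "(\<Sum>i = 1..N. \<Sum>j = t i..k. deg \<Lambda> (ls ! (i - 1)) j * unit_deg j p) =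
      (\<Sum>i = 1..N. if i \<le> q then deg \<Lambda> (ls ! (i - 1)) p else 0)"
  proof (rule sum.cong[OF refl])
    fix i assume i: "i \<in> {1..N}"
    let ?d = "deg \<Lambda> (ls ! (i - 1))"
    have "ls ! (i - 1) \<in> mor \<Lambda>"
    proof -
      have "i - 1 < length ls" using i assms(2) by auto
      then show ?thesis using assms(1) nth_mem by blast
    qed
    then have "?d p = 0" if "\<not> p \<le> k" using deg_Nk that by (auto simp: Nk_def)
    moreover have "(\<Sum>j = t i..k. ?d j * unit_deg j p) = (\<Sum>j = t i..k. if j = p then ?d p else 0)"
      by (rule sum.cong) (auto simp: unit_deg_def)
    ultimately show "(\<Sum>j = t i..k. ?d j * unit_deg j p) = (if i \<le> q then ?d p else 0)"
      using assms(4)[OF i] by auto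
  qed
  also have "\<dots> = (\<Sum>i = 1..q. deg \<Lambda> (ls ! (i - 1)) p)"
    by (rule sum.mono_neutral_cong_right) (use assms(3) in auto)
  also have "\<dots> = cumdeg \<Lambda> ls q p"
    using assms(2,3) by (simp add: cumdeg_apply)
  finally show ?thesis .
qed

text \<open>In colour \<open>p\<close> the corners are \<open>b\<^sub>p = D\<^sub>q(p)\<close> with \<open>q = r\<^sub>K(p)\<close>, and \<open>c\<^sub>p = D\<^sub>q(p)\<close> with
  \<open>q = r\<^sub>K(p + 1)\<close>.  They differ only for \<open>p\<close> in \<open>K\<close>, so translating by \<open>b\<close> maps the positions in
  the bracket onto the box.\<close>

lemma bracket_square_hat:
  assumes "composable \<Lambda> v ls" "length ls = Suc N" "K \<subseteq> {1..k}" "card K = N"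
  shows "bracket (path_graph \<Lambda> v) (square_hat k \<Lambda> N ls K) K =
    cube_sum \<Lambda> (composite \<Lambda> ls) (cumdeg \<Lambda> ls) (rank K) K"
proof -
  let ?\<kappa> = "composite \<Lambda> ls"
  have fin: "finite K" using assms(3) finite_subset by blast
  have k: "?\<kappa> \<in> mor \<Lambda>" "src \<Lambda> ?\<kappa> = v" "deg \<Lambda> ?\<kappa> = cumdeg \<Lambda> ls (Suc N)"
    using composite_props[OF assms(1)] assms(2) by simp_all
  have ls: "set ls \<subseteq> mor \<Lambda>" using assms(1) by (rule composable_set)
  define b where "b = (\<lambda>p. cumdeg \<Lambda> ls (rank K p) p)"
  define c where "c = (\<lambda>p. cumdeg \<Lambda> ls (rank K (Suc p)) p)"
  have rN: "rank K p \<le> N" for p using rank_le_card[OF fin] assms(4) by metis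
  have b: "(\<lambda>p. \<Sum>i=1..N. \<Sum>j=nth_smallest K i + 1..k. deg \<Lambda> (ls ! (i - 1)) j * unit_deg j p) = b"
    unfolding b_def
  proof (rule ext, rule sum_cutoff[OF ls _ rN])
    fix p i assume "i \<in> {1..N}"
    then show "nth_smallest K i + 1 \<le> p \<longleftrightarrow> i \<le> rank K p"
      using nth_smallest_less_iff[OF fin, of i p] assms(4) by (simp add: less_eq_Suc_le)
  qed (use assms(2) in simp)
  have c: "(\<lambda>p. \<Sum>i=1..N. \<Sum>j=nth_smallest K i..k. deg \<Lambda> (ls ! (i - 1)) j * unit_deg j p) = c"
    unfolding c_def
  proof (rule ext, rule sum_cutoff[OF ls _ rN])
    fix p i assume "i \<in> {1..N}"
    then show "nth_smallest K i \<le> p \<longleftrightarrow> i \<le> rank K (Suc p)"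
      using nth_smallest_less_iff[OF fin, of i "Suc p"] assms(4) by (simp add: less_Suc_eq_le)
  qed (use assms(2) in simp)
  have bc: "b \<le> c"
    unfolding b_def c_def le_fun_def by (intro allI cumdeg_mono rank_mono fin) simp
  have cd: "c \<le> deg \<Lambda> ?\<kappa>"
    unfolding c_def k(3) using rN by (auto intro!: le_funI cumdeg_mono le_SucI)
  have hat: "square_hat k \<Lambda> N ls K = (seg \<Lambda> ?\<kappa> b c, seg \<Lambda> ?\<kappa> c (deg \<Lambda> ?\<kappa>))"
    unfolding square_hat_def b c by (simp add: Let_def)
  have deg: "deg (path_graph \<Lambda> v) (square_hat k \<Lambda> N ls K) = c - b"
    using k bc cd by (simp add: hat deg_seg)
  have "bracket (path_graph \<Lambda> v) (square_hat k \<Lambda> N ls K) K =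
      (\<Sum>m | m + eK K \<le> c - b. gen \<Lambda> ?\<kappa> (b + m) K)"
    unfolding bracket_def deg
  proof (rule sum.cong[OF refl])
    fix m assume "m \<in> {m. m + eK K \<le> c - b}"
    then have m: "m + eK K \<le> c - b" by simp
    show "frag_of (Some (seg (path_graph \<Lambda> v) (square_hat k \<Lambda> N ls K) m (m + eK K))) =
        gen \<Lambda> ?\<kappa> (b + m) K"
      unfolding hat using seg_path_graph[OF k(1,2) bc cd _ m, of m]
      by (simp add: cube_def le_fun_def add.assoc)
  qed
  also have "\<dots> = cube_sum \<Lambda> ?\<kappa> (cumdeg \<Lambda> ls) (rank K) K"
    unfolding cube_sum_def
  proof (rule sum.reindex_bij_witness[of _ "\<lambda>m. m - b" "\<lambda>m. b + m"])
    have mem: "m \<in> stage_box (cumdeg \<Lambda> ls) (rank K) K \<longleftrightarrow>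
        (\<forall>p. if p \<in> K then b p \<le> m p \<and> m p < c p else m p = b p)" for m
      unfolding stage_box_def box_def b_def c_def by (auto simp: rank_Suc[OF fin])
    have cb: "c p = b p" if "p \<notin> K" for p
      using that by (simp add: b_def c_def rank_Suc[OF fin])
    have "m - b + eK K \<le> c - b \<and> b + (m - b) = m" if "m \<in> stage_box (cumdeg \<Lambda> ls) (rank K) K" for m
    proof (intro conjI le_funI ext)
      fix p
      have p: "if p \<in> K then b p \<le> m p \<and> m p < c p else m p = b p" using that mem by blast
      show "(m - b + eK K) p \<le> (c - b) p"
        using p cb[of p] by (cases "p \<in> K") (auto simp: eK_apply[OF fin])
      show "(b + (m - b)) p = m p"
        using p by (cases "p \<in> K") simp_all
    qed
    then show "m - b \<in> {m. m + eK K \<le> c - b}" "b + (m - b) = m"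
      if "m \<in> stage_box (cumdeg \<Lambda> ls) (rank K) K" for m
      using that by simp_all
    show "b + m - b = m" for m by (simp add: fun_eq_iff)
    show "b + m \<in> stage_box (cumdeg \<Lambda> ls) (rank K) K" if "m \<in> {m. m + eK K \<le> c - b}" for m
      unfolding mem
    proof
      fix p
      have "m p + eK K p \<le> c p - b p" using that by (simp add: le_fun_def)
      then show "if p \<in> K then b p \<le> (b + m) p \<and> (b + m) p < c p else (b + m) p = b p"
        using cb[of p] by (cases "p \<in> K") (simp_all add: eK_apply[OF fin])
    qed
  qed simp
  finally show ?thesis .
qed

lemma square_of_tuple:
  assumes "composable \<Lambda> v ls" "length ls = Suc N"
  shows "square k \<Lambda> (int N) v (frag_of (Some ls)) =
    (\<Sum>K | K \<subseteq> {1..k} \<and> card K = N. cube_sum \<Lambda> (composite \<Lambda> ls) (cumdeg \<Lambda> ls) (rank K) K)"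
  using assms by (simp add: square_def bracket_square_hat)

lemma stage_box_rank_bound:
  assumes "composable \<Lambda> v ls" "K \<subseteq> {1..k}" "card K < length ls"
    "m \<in> stage_box (cumdeg \<Lambda> ls) (rank K) K"
  shows "m + eK K \<le> cumdeg \<Lambda> ls (card K)" "m + eK K \<le> deg \<Lambda> (composite \<Lambda> ls)"
proof -
  have fin: "finite K" using assms(2) finite_subset by blast
  show 1: "m + eK K \<le> cumdeg \<Lambda> ls (card K)"
    using stage_box_bound[OF assms(4) fin rank_le_card[OF fin] rank_less_card[OF fin] cumdeg_mono]
    by blast
  have "cumdeg \<Lambda> ls (card K) \<le> deg \<Lambda> (composite \<Lambda> ls)"
    using composite_props[OF assms(1)] assms(3) by (auto intro!: le_funI cumdeg_mono)
  with 1 show "m + eK K \<le> deg \<Lambda> (composite \<Lambda> ls)" by (rule order_trans)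
qed

section \<open>Compatibility with the boundaries\<close>

text \<open>For fixed \<open>c\<close> the signs do not depend on the position, so the sum over positions can be taken
  first, where it telescopes.\<close>

lemma cube_boundary_cube_sum:
  assumes "composable \<Lambda> v ls" "K \<subseteq> {1..k}" "card K \<ge> 1" "card K < length ls"
  defines "D \<equiv> cumdeg \<Lambda> ls" and "\<kappa> \<equiv> composite \<Lambda> ls"
  shows "cube_boundary k (path_graph \<Lambda> v) (int (card K)) (cube_sum \<Lambda> \<kappa> D (rank K) K) =
    (\<Sum>c\<in>K. frag_cmul ((-1) ^ (rank (K - {c}) c + 1))
      (cube_sum \<Lambda> \<kappa> D (\<lambda>j. rank (K - {c}) j + of_bool (c + 1 \<le> j)) (K - {c}) -
       cube_sum \<Lambda> \<kappa> D (\<lambda>j. rank (K - {c}) j + of_bool (c \<le> j)) (K - {c})))"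
proof -
  have fin: "finite K" using assms(2) finite_subset by blast
  have k: "\<kappa> \<in> mor \<Lambda>" "src \<Lambda> \<kappa> = v" using composite_props[OF assms(1)] by (simp_all add: \<kappa>_def)
  let ?B = "stage_box D (rank K) K"
  have "cube_boundary k (path_graph \<Lambda> v) (int (card K)) (cube_sum \<Lambda> \<kappa> D (rank K) K) =
      (\<Sum>m\<in>?B. cube_boundary k (path_graph \<Lambda> v) (int (card K)) (gen \<Lambda> \<kappa> m K))"
    by (simp add: cube_boundary_def cube_sum_def frag_extend_sum finite_stage_box fin)
  also have "\<dots> = (\<Sum>m\<in>?B. \<Sum>c\<in>K. frag_cmul ((-1) ^ (rank K c + 1))
      (gen \<Lambda> \<kappa> m (K - {c}) - gen \<Lambda> \<kappa> (m + unit_deg c) (K - {c})))"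
  proof (rule sum.cong[OF refl])
    fix m assume "m \<in> ?B"
    then have "m + eK K \<le> deg \<Lambda> \<kappa>"
      unfolding D_def \<kappa>_def by (rule stage_box_rank_bound(2)[OF assms(1,2,4)])
    then show "cube_boundary k (path_graph \<Lambda> v) (int (card K)) (gen \<Lambda> \<kappa> m K) =
      (\<Sum>c\<in>K. frag_cmul ((-1) ^ (rank K c + 1))
        (gen \<Lambda> \<kappa> m (K - {c}) - gen \<Lambda> \<kappa> (m + unit_deg c) (K - {c})))"
      using cube_boundary_gen[OF k(1) _ assms(2,3)] k(2) by simp
  qed
  also have "\<dots> = (\<Sum>c\<in>K. frag_cmul ((-1) ^ (rank K c + 1))
      (\<Sum>m\<in>?B. gen \<Lambda> \<kappa> m (K - {c}) - gen \<Lambda> \<kappa> (m + unit_deg c) (K - {c})))"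
    by (subst sum.swap) (simp only: frag_cmul_sum)
  also have "\<dots> = (\<Sum>c\<in>K. frag_cmul ((-1) ^ (rank (K - {c}) c + 1))
      (cube_sum \<Lambda> \<kappa> D (\<lambda>j. rank (K - {c}) j + of_bool (c + 1 \<le> j)) (K - {c}) -
       cube_sum \<Lambda> \<kappa> D (\<lambda>j. rank (K - {c}) j + of_bool (c \<le> j)) (K - {c})))"
  proof (rule sum.cong[OF refl])
    fix c assume "c \<in> K"
    then have K: "insert c (K - {c}) = K" by blast
    have "rank (insert c (K - {c})) c = rank (K - {c}) c + of_bool (c < c)"
      by (rule rank_insert) (simp_all add: fin)
    then have r: "rank K c = rank (K - {c}) c" unfolding K by simp
    show "frag_cmul ((-1) ^ (rank K c + 1))
        (\<Sum>m\<in>?B. gen \<Lambda> \<kappa> m (K - {c}) - gen \<Lambda> \<kappa> (m + unit_deg c) (K - {c})) =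
      frag_cmul ((-1) ^ (rank (K - {c}) c + 1))
      (cube_sum \<Lambda> \<kappa> D (\<lambda>j. rank (K - {c}) j + of_bool (c + 1 \<le> j)) (K - {c}) -
       cube_sum \<Lambda> \<kappa> D (\<lambda>j. rank (K - {c}) j + of_bool (c \<le> j)) (K - {c}))"
      using sum_stage_box_difference[of "K - {c}" c D "\<lambda>m. gen \<Lambda> \<kappa> m (K - {c})"] fin
      by (simp only: K r) (simp add: cube_sum_def D_def cumdeg_Suc_mono)
  qed
  finally show ?thesis .
qed

text \<open>A set with a distinguished element amounts to a smaller set and an element outside it.\<close>

lemma sum_choose_then_remove:
  assumes "N \<ge> 1"
  shows "(\<Sum>K | K \<subseteq> {1..k} \<and> card K = N. \<Sum>c\<in>K. F (K - {c}) c) =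
    (\<Sum>L | L \<subseteq> {1..k} \<and> card L = N - 1. \<Sum>c\<in>{1..k} - L. F L c)"
proof -
  let ?A = "\<lambda>N. {K. K \<subseteq> {1..k} \<and> card K = N}"
  have fA: "finite (?A n)" for n by simp
  have fin: "finite K" if "K \<subseteq> {1..k}" for K using that finite_subset by blast
  have "(\<Sum>K\<in>?A N. \<Sum>c\<in>K. F (K - {c}) c) = (\<Sum>(K, c)\<in>Sigma (?A N) (\<lambda>K. K). F (K - {c}) c)"
    using fA fin by (intro sum.Sigma) auto
  also have "\<dots> = (\<Sum>(L, c)\<in>Sigma (?A (N - 1)) (\<lambda>L. {1..k} - L). F L c)"
    by (rule sum.reindex_bij_witness[of _ "\<lambda>(L, c). (insert c L, c)" "\<lambda>(K, c). (K - {c}, c)"])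
      (use assms in \<open>auto simp: insert_absorb fin\<close>)
  also have "\<dots> = (\<Sum>L\<in>?A (N - 1). \<Sum>c\<in>{1..k} - L. F L c)"
    using fA by (intro sum.Sigma[symmetric]) auto
  finally show ?thesis .
qed

text \<open>Removing \<open>x\<close> subtracts its degree from all later partial degrees.  Translating back by the degree
  of \<open>x\<close> raises the stage of every colour by one, which is the threshold \<open>1\<close>: the index 0 is not a
  colour, and all degrees vanish there.\<close>

lemma cube_sum_tl:
  assumes "composable \<Lambda> v (x # ls)" "ls \<noteq> []" "L \<subseteq> {1..k}" "card L < length ls"
  shows "cube_sum \<Lambda> (composite \<Lambda> ls) (cumdeg \<Lambda> ls) (rank L) L =
    cube_sum \<Lambda> (composite \<Lambda> (x # ls)) (cumdeg \<Lambda> (x # ls)) (\<lambda>j. rank L j + of_bool (1 \<le> j)) L"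
proof -
  have c: "x \<in> mor \<Lambda>" "composable \<Lambda> v ls" "src \<Lambda> x = rng \<Lambda> (composite \<Lambda> ls)"
    "composite \<Lambda> ls \<in> mor \<Lambda>"
    using assms(1,2) composite_props[of v ls] by (simp_all add: composable_Cons)
  have set: "set (x # ls) \<subseteq> mor \<Lambda>" using assms(1) by (rule composable_set)
  let ?D = "cumdeg \<Lambda> ls" and ?D' = "cumdeg \<Lambda> (x # ls)"
  have shift: "?D' (q + of_bool (1 \<le> j)) j = deg \<Lambda> x j + ?D q j" for q j
  proof (cases "1 \<le> j")
    case True
    then show ?thesis by (simp add: cumdeg_Cons_Suc)
  next
    case False
    then have "?D' q' j = 0" for q' using set by (intro cumdeg_outside) auto
    moreover have "?D q j = 0" "deg \<Lambda> x j = 0"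
      using False set cumdeg_outside[of ls j q] deg_Nk[OF c(1)] by (auto simp: Nk_def)
    ultimately show ?thesis by simp
  qed
  have shift': "?D' (Suc (q + of_bool (1 \<le> j))) j = deg \<Lambda> x j + ?D (Suc q) j" for q j
    using shift[of "Suc q" j] by simp
  have mem: "deg \<Lambda> x + m \<in> stage_box ?D' (\<lambda>j. rank L j + of_bool (1 \<le> j)) L \<longleftrightarrow>
      m \<in> stage_box ?D (rank L) L" for m
    unfolding stage_box_def box_def by (simp only: shift shift' plus_fun_apply mem_Collect_eq) simp
  have inv: "deg \<Lambda> x + (m - deg \<Lambda> x) = m"
    if "m \<in> stage_box ?D' (\<lambda>j. rank L j + of_bool (1 \<le> j)) L" for m
  proof (rule fun_add_diff_inverse, rule le_funI)
    fix j
    have "?D' (rank L j + of_bool (1 \<le> j)) j \<le> m j"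
      using that by (cases "j \<in> L") (auto simp: stage_box_def box_def dest!: spec[of _ j])
    then show "deg \<Lambda> x j \<le> m j" unfolding shift by simp
  qed
  show ?thesis unfolding cube_sum_def
  proof (rule sum.reindex_bij_witness[of _ "\<lambda>m. m - deg \<Lambda> x" "\<lambda>m. deg \<Lambda> x + m"])
    fix m assume m: "m \<in> stage_box ?D (rank L) L"
    show "deg \<Lambda> x + m - deg \<Lambda> x = m" by (simp add: fun_eq_iff)
    show "deg \<Lambda> x + m \<in> stage_box ?D' (\<lambda>j. rank L j + of_bool (1 \<le> j)) L"
      using m mem by blast
    show "gen \<Lambda> (composite \<Lambda> (x # ls)) (deg \<Lambda> x + m) L = gen \<Lambda> (composite \<Lambda> ls) m L"
      using cube_suffix[OF c(1,4,3) stage_box_rank_bound(2)[OF c(2) assms(3,4) m]] assms(2)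
      by (simp add: composite_Cons)
  next
    fix m assume m: "m \<in> stage_box ?D' (\<lambda>j. rank L j + of_bool (1 \<le> j)) L"
    show "deg \<Lambda> x + (m - deg \<Lambda> x) = m" using m by (rule inv)
    then show "m - deg \<Lambda> x \<in> stage_box ?D (rank L) L"
      using mem[of "m - deg \<Lambda> x"] m by simp
  qed
qed

text \<open>The breakpoint that is lost lies beyond all stages used by \<open>L\<close>; and the threshold \<open>k + 1\<close> raises
  the stage only at indices above \<open>k\<close>, where all degrees vanish.\<close>

lemma cube_sum_last_merge:
  assumes "composable \<Lambda> v ls" "L \<subseteq> {1..k}"
  shows "cube_sum \<Lambda> \<kappa> (cumdeg \<Lambda> ls \<circ> skip (card L + 1)) (rank L) L =
    cube_sum \<Lambda> \<kappa> (cumdeg \<Lambda> ls) (\<lambda>j. rank L j + of_bool (k + 1 \<le> j)) L"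
proof -
  have fin: "finite L" using assms(2) finite_subset by blast
  have set: "set ls \<subseteq> mor \<Lambda>" using assms(1) by (rule composable_set)
  have "stage_box (cumdeg \<Lambda> ls \<circ> skip (card L + 1)) (rank L) L =
      stage_box (cumdeg \<Lambda> ls) (\<lambda>j. rank L j + of_bool (k + 1 \<le> j)) L"
    unfolding stage_box_def
  proof (rule box_cong)
    fix j
    have "skip (card L + 1) (rank L j) = rank L j"
      using rank_le_card[OF fin, of j] by (simp add: skip_def)
    then show "(cumdeg \<Lambda> ls \<circ> skip (card L + 1)) (rank L j) j =
        cumdeg \<Lambda> ls (rank L j + of_bool (k + 1 \<le> j)) j"
      using cumdeg_outside[OF set, of j] by (cases "k + 1 \<le> j") simp_all
    assume j: "j \<in> L"
    then have "\<not> k + 1 \<le> j" using assms(2) by auto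
    then show "(cumdeg \<Lambda> ls \<circ> skip (card L + 1)) (Suc (rank L j)) j =
        cumdeg \<Lambda> ls (Suc (rank L j + of_bool (k + 1 \<le> j))) j"
      using rank_less_card[OF fin j] by (simp add: skip_def)
  qed
  then show ?thesis by (simp add: cube_sum_def)
qed

text \<open>Both sides are regrouped as sums over the colour sets \<open>L\<close> with \<open>N - 1\<close> elements; for each single
  \<open>L\<close> the identity is then \<open>alternating_telescope\<close>.\<close>

lemma boundary_square_tuple:
  assumes "composable \<Lambda> v ls" "length ls = Suc N" "N \<ge> 1"
  shows "cube_boundary k (path_graph \<Lambda> v) (int N) (square k \<Lambda> (int N) v (frag_of (Some ls))) =
    square k \<Lambda> (int N - 1) v (simplex_boundary \<Lambda> (int N) v (frag_of (Some ls)))"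
proof -
  let ?\<kappa> = "composite \<Lambda> ls" and ?D = "cumdeg \<Lambda> ls"
  let ?sub = "\<lambda>n. {K. K \<subseteq> {1..k} \<and> card K = n}"
  define S where "S L t = cube_sum \<Lambda> ?\<kappa> ?D (\<lambda>j. rank L j + of_bool (t \<le> j)) L" for L t
  define X where "X i L = cube_sum \<Lambda> ?\<kappa> (?D \<circ> skip i) (rank L) L" for i L
  have finsub: "finite (?sub n)" for n by simp
  have "cube_boundary k (path_graph \<Lambda> v) (int N) (square k \<Lambda> (int N) v (frag_of (Some ls))) =
      (\<Sum>K\<in>?sub N. cube_boundary k (path_graph \<Lambda> v) (int N) (cube_sum \<Lambda> ?\<kappa> ?D (rank K) K))"
    unfolding square_of_tuple[OF assms(1,2)] cube_boundary_def
    by (simp only: frag_extend_sum[OF finsub] o_def)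
  also have "\<dots> = (\<Sum>K\<in>?sub N. \<Sum>c\<in>K. frag_cmul ((-1) ^ (rank (K - {c}) c + 1))
      (S (K - {c}) (c + 1) - S (K - {c}) c))"
    by (rule sum.cong[OF refl])
      (use cube_boundary_cube_sum[OF assms(1)] assms(2,3) in \<open>auto simp: S_def\<close>)
  also have "\<dots> = (\<Sum>L\<in>?sub (N - 1). \<Sum>c\<in>{1..k} - L. frag_cmul ((-1) ^ (rank L c + 1))
      (S L (c + 1) - S L c))"
    by (rule sum_choose_then_remove[OF assms(3),
          of "\<lambda>L c. frag_cmul ((-1) ^ (rank L c + 1)) (S L (c + 1) - S L c)"])
  also have "\<dots> = (\<Sum>L\<in>?sub (N - 1). S L 1 + (\<Sum>i = 1..N. frag_cmul ((-1) ^ i) (X i L)))"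
  proof (rule sum.cong[OF refl])
    fix L assume "L \<in> ?sub (N - 1)"
    then have L: "L \<subseteq> {1..k}" "card L + 1 = N" using assms(3) by auto
    have fin: "finite L" using L finite_subset by blast
    have inner: "S L c + S L (c + 1) = X (rank L c + 1) L" if "c \<in> L" for c
      using sum_stage_box_skip[OF fin that, of ?D "\<lambda>m. gen \<Lambda> ?\<kappa> m L"]
      by (simp add: S_def X_def cube_sum_def cumdeg_Suc_mono)
    \<comment> \<open>An element \<open>c\<close> of \<open>L\<close> accounts for the merge at \<open>rank L c + 1\<close>, so the elements of \<open>L\<close> exhaust the
      merges at \<open>1, \<dots>, N - 1\<close>; the merge at \<open>N\<close> is the end of the telescope.\<close>
    have last: "S L (k + 1) = X (card L + 1) L"
      unfolding S_def X_def by (rule cube_sum_last_merge[OF assms(1) L(1), symmetric])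
    have "(\<Sum>c\<in>{1..k} - L. frag_cmul ((-1) ^ (rank L c + 1)) (S L (c + 1) - S L c)) =
        S L 1 + (\<Sum>c\<in>L. frag_cmul ((-1) ^ (rank L c + 1)) (X (rank L c + 1) L))
        + frag_cmul ((-1) ^ (card L + 1)) (X (card L + 1) L)"
      unfolding alternating_telescope[OF L(1)] last by (simp only: inner cong: sum.cong)
    also have "(\<Sum>c\<in>L. frag_cmul ((-1) ^ (rank L c + 1)) (X (rank L c + 1) L)) =
        (\<Sum>i = 1..card L. frag_cmul ((-1) ^ i) (X i L))"
      unfolding sum_over_ranks[OF fin, of "\<lambda>i c. frag_cmul ((-1) ^ (i + 1)) (X (i + 1) L)"]
      by (rule sum.cong) auto
    finally show "(\<Sum>c\<in>{1..k} - L. frag_cmul ((-1) ^ (rank L c + 1)) (S L (c + 1) - S L c)) =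
        S L 1 + (\<Sum>i = 1..N. frag_cmul ((-1) ^ i) (X i L))"
      by (simp add: add.assoc flip: L(2))
  qed
  also have "\<dots> = (\<Sum>L\<in>?sub (N - 1). S L 1) +
      (\<Sum>i = 1..N. frag_cmul ((-1) ^ i) (\<Sum>L\<in>?sub (N - 1). X i L))"
    by (simp only: sum.distrib frag_cmul_sum) (subst (2) sum.swap, rule refl)
  also have "(\<Sum>L\<in>?sub (N - 1). S L 1) = square k \<Lambda> (int (N - 1)) v (frag_of (Some (tl ls)))"
  proof -
    obtain x ls' where ls: "ls = x # ls'" using assms(2) by (cases ls) auto
    have ne: "ls' \<noteq> []" using assms(2,3) ls by auto
    have c: "composable \<Lambda> v ls'" "length ls' = Suc (N - 1)"
      using assms ls ne by (simp_all add: composable_Cons)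
    have "S L 1 = cube_sum \<Lambda> (composite \<Lambda> ls') (cumdeg \<Lambda> ls') (rank L) L" if "L \<in> ?sub (N - 1)" for L
      using cube_sum_tl[of v x ls' L] that assms(1) c(2) ls ne by (simp add: S_def)
    then show ?thesis unfolding ls list.sel square_of_tuple[OF c] by simp
  qed
  also have "(\<Sum>i = 1..N. frag_cmul ((-1) ^ i) (\<Sum>L\<in>?sub (N - 1). X i L)) =
      (\<Sum>i = 1..N. frag_cmul ((-1) ^ i) (square k \<Lambda> (int (N - 1)) v (frag_of (Some (merge \<Lambda> i ls)))))"
  proof (rule sum.cong[OF refl])
    fix i assume "i \<in> {1..N}"
    then have i: "i \<in> {1..<length ls}" using assms(2) by auto
    have l: "length (merge \<Lambda> i ls) = Suc (N - 1)"
      using length_merge[OF assms(1) i] assms(2,3) by simp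
    show "frag_cmul ((-1) ^ i) (\<Sum>L\<in>?sub (N - 1). X i L) =
        frag_cmul ((-1) ^ i) (square k \<Lambda> (int (N - 1)) v (frag_of (Some (merge \<Lambda> i ls))))"
      unfolding square_of_tuple[OF composable_merge[OF assms(1) i] l]
      by (simp add: X_def composite_merge[OF assms(1) i] cumdeg_merge[OF assms(1) i])
  qed
  also have "int (N - 1) = int N - 1" using assms(3) by simp
  finally have "cube_boundary k (path_graph \<Lambda> v) (int N) (square k \<Lambda> (int N) v (frag_of (Some ls))) =
      square k \<Lambda> (int N - 1) v (frag_of (Some (tl ls))) +
      (\<Sum>i = 1..N. frag_cmul ((-1) ^ i) (square k \<Lambda> (int N - 1) v (frag_of (Some (merge \<Lambda> i ls)))))" .
  also have "\<dots> = square k \<Lambda> (int N - 1) v (frag_of (Some (tl ls)) +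
      (\<Sum>i = 1..N. frag_cmul ((-1) ^ i) (frag_of (Some (merge \<Lambda> i ls)))))"
    by (simp only: square_def frag_extend_add frag_extend_sum[OF finite_atLeastAtMost]
        frag_extend_cmul o_def)
  finally show ?thesis using assms(3) by (simp add: simplex_boundary_def)
qed

end

section \<open>Modules spanned by sets of generators\<close>

lemma frag_extend_frag_extend:
  "frag_extend f (frag_extend g x) = frag_extend (\<lambda>a. frag_extend f (g a)) x"
proof -
  have "Poly_Mapping.keys x \<subseteq> UNIV" by simp
  then show ?thesis by (induction x rule: frag_induction) (simp_all add: frag_extend_diff)
qed

lemma keys_frag_extend_subset:
  assumes "Poly_Mapping.keys x \<subseteq> S" "\<And>a. a \<in> S \<Longrightarrow> Poly_Mapping.keys (f a) \<subseteq> T"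
  shows "Poly_Mapping.keys (frag_extend f x) \<subseteq> T"
  using keys_frag_extend[of f x] assms by blast

lemma frag_extend_hom:
  assumes "\<And>a. a \<in> S \<Longrightarrow> Poly_Mapping.keys (f a) \<subseteq> T"
  shows "frag_extend f \<in> hom (free_Abelian_group S) (free_Abelian_group T)"
  unfolding hom_def using assms keys_frag_extend_subset
  by (auto simp: frag_extend_add simp del: subset_iff) blast

lemma frag_extend_eq_on:
  assumes "Poly_Mapping.keys x \<subseteq> S" "\<And>a. a \<in> S \<Longrightarrow> f a = g a"
  shows "frag_extend f x = frag_extend g x"
  by (rule frag_extend_eq) (use assms in blast)

text \<open>The common form of the module groups: free on a set of generators, where each
  morphism \<open>\<kappa>\<close> acts by sending generators to generators through \<open>h \<kappa>\<close>.  The module axioms and naturality then need to be seen on generators only.\<close>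

definition span_module :: "('a \<Rightarrow> 'x set) \<Rightarrow> ('a \<Rightarrow> 'x \<Rightarrow> 'x) \<Rightarrow> ('a, 'x \<Rightarrow>\<^sub>0 int) rmodule" where
  "span_module S h =
     \<lparr> grp = (\<lambda>v. free_Abelian_group (S v)), act = (\<lambda>\<kappa>. frag_extend (\<lambda>x. frag_of (h \<kappa> x))) \<rparr>"

lemma right_module_span:
  assumes mem: "\<And>\<kappa> x. \<kappa> \<in> mor \<Lambda> \<Longrightarrow> x \<in> S (rng \<Lambda> \<kappa>) \<Longrightarrow> h \<kappa> x \<in> S (src \<Lambda> \<kappa>)"
    and unit: "\<And>v x. v \<in> vertices \<Lambda> \<Longrightarrow> x \<in> S v \<Longrightarrow> h v x = x"
    and assoc: "\<And>\<mu> \<nu> x. \<lbrakk>\<mu> \<in> mor \<Lambda>; \<nu> \<in> mor \<Lambda>; src \<Lambda> \<mu> = rng \<Lambda> \<nu>; x \<in> S (rng \<Lambda> \<mu>)\<rbrakk>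
      \<Longrightarrow> h (cmp \<Lambda> \<mu> \<nu>) x = h \<nu> (h \<mu> x)"
  shows "right_module \<Lambda> (span_module S h)"
  unfolding right_module_def
proof (intro conjI ballI impI)
  fix v show "comm_group (grp (span_module S h) v)"
    by (simp add: span_module_def abelian_free_Abelian_group)
next
  fix \<kappa> assume "\<kappa> \<in> mor \<Lambda>"
  then show "act (span_module S h) \<kappa> \<in>
      hom (grp (span_module S h) (rng \<Lambda> \<kappa>)) (grp (span_module S h) (src \<Lambda> \<kappa>))"
    unfolding span_module_def rmodule.simps by (intro frag_extend_hom) (simp add: mem)
next
  fix v x assume v: "v \<in> vertices \<Lambda>" and "x \<in> carrier (grp (span_module S h) v)"
  then have "Poly_Mapping.keys x \<subseteq> S v" by (simp add: span_module_def)
  then have "frag_extend (\<lambda>a. frag_of (h v a)) x = frag_extend frag_of x"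
    by (rule frag_extend_eq_on) (simp add: unit[OF v])
  then show "act (span_module S h) v x = x"
    using frag_expansion[of x] by (simp add: span_module_def)
next
  fix \<mu> \<nu> x assume m: "\<mu> \<in> mor \<Lambda>" "\<nu> \<in> mor \<Lambda>" "src \<Lambda> \<mu> = rng \<Lambda> \<nu>"
    and "x \<in> carrier (grp (span_module S h) (rng \<Lambda> \<mu>))"
  then have "Poly_Mapping.keys x \<subseteq> S (rng \<Lambda> \<mu>)" by (simp add: span_module_def)
  then have "frag_extend (\<lambda>a. frag_of (h (cmp \<Lambda> \<mu> \<nu>) a)) x = frag_extend (\<lambda>a. frag_of (h \<nu> (h \<mu> a))) x"
    by (rule frag_extend_eq_on) (simp add: assoc[OF m])
  then show "act (span_module S h) (cmp \<Lambda> \<mu> \<nu>) x =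
      act (span_module S h) \<nu> (act (span_module S h) \<mu> x)"
    by (simp add: span_module_def frag_extend_frag_extend)
qed

lemma module_map_span:
  assumes "right_module \<Lambda> (span_module S h)" "right_module \<Lambda> (span_module T g)"
    and mem: "\<And>v x. v \<in> vertices \<Lambda> \<Longrightarrow> x \<in> S v \<Longrightarrow> Poly_Mapping.keys (f v x) \<subseteq> T v"
    and nat: "\<And>\<kappa> x. \<lbrakk>\<kappa> \<in> mor \<Lambda>; x \<in> S (rng \<Lambda> \<kappa>)\<rbrakk> \<Longrightarrow>
      f (src \<Lambda> \<kappa>) (h \<kappa> x) = frag_extend (\<lambda>y. frag_of (g \<kappa> y)) (f (rng \<Lambda> \<kappa>) x)"
  shows "module_map \<Lambda> (span_module S h) (span_module T g) (\<lambda>v. frag_extend (f v))"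
  unfolding module_map_def
proof (intro conjI ballI assms(1,2))
  fix v assume "v \<in> vertices \<Lambda>"
  then show "frag_extend (f v) \<in> hom (grp (span_module S h) v) (grp (span_module T g) v)"
    unfolding span_module_def rmodule.simps by (intro frag_extend_hom mem)
next
  fix \<kappa> x assume k: "\<kappa> \<in> mor \<Lambda>" and "x \<in> carrier (grp (span_module S h) (rng \<Lambda> \<kappa>))"
  then have "Poly_Mapping.keys x \<subseteq> S (rng \<Lambda> \<kappa>)" by (simp add: span_module_def)
  then show "frag_extend (f (src \<Lambda> \<kappa>)) (act (span_module S h) \<kappa> x) =
      act (span_module T g) \<kappa> (frag_extend (f (rng \<Lambda> \<kappa>)) x)"
    unfolding span_module_def rmodule.simps frag_extend_frag_extend frag_extend_of
    by (rule frag_extend_eq_on) (rule nat[OF k])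
qed

definition simplex_gens :: "'a kgraph \<Rightarrow> int \<Rightarrow> 'a \<Rightarrow> 'a list option set" where
  "simplex_gens \<Lambda> n v =
     (if n \<ge> 0 then Some ` tuples \<Lambda> (nat n + 1) v else if n = -1 then {None} else {})"

definition cube_gens :: "nat \<Rightarrow> 'a kgraph \<Rightarrow> int \<Rightarrow> 'a \<Rightarrow> ('a \<times> 'a) option set" where
  "cube_gens k \<Lambda> n v =
     (if n \<ge> 0 then Some ` cubes k (path_graph \<Lambda> v) (nat n) else if n = -1 then {None} else {})"

definition extend_tuple :: "'a kgraph \<Rightarrow> 'a \<Rightarrow> 'a list \<Rightarrow> 'a list" where
  "extend_tuple \<Lambda> \<kappa> ls = butlast ls @ [cmp \<Lambda> (last ls) \<kappa>]"

definition extend_path :: "'a kgraph \<Rightarrow> 'a \<Rightarrow> 'a \<times> 'a \<Rightarrow> 'a \<times> 'a" where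
  "extend_path \<Lambda> \<kappa> = (\<lambda>(\<eta>, \<mu>). (\<eta>, cmp \<Lambda> \<mu> \<kappa>))"

lemma const_module_span:
  "const_module = span_module (\<lambda>v. {None}) (\<lambda>\<kappa> x. x)"
  by (simp add: const_module_def span_module_def fun_eq_iff flip: frag_expansion)

lemma right_module_const: "right_module \<Lambda> const_module"
  unfolding const_module_span by (rule right_module_span) simp_all

lemma simplex_module_span:
  "n \<noteq> -1 \<Longrightarrow> simplex_module \<Lambda> n =
    span_module (simplex_gens \<Lambda> n) (\<lambda>\<kappa>. map_option (extend_tuple \<Lambda> \<kappa>))"
  by (simp add: simplex_module_def span_module_def simplex_gens_def extend_tuple_def[abs_def] fun_eq_iff)

lemma cube_module_span:
  "n \<noteq> -1 \<Longrightarrow> cube_module k \<Lambda> n =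
    span_module (cube_gens k \<Lambda> n) (\<lambda>\<kappa>. map_option (extend_path \<Lambda> \<kappa>))"
  by (simp add: cube_module_def cube_group_def span_module_def cube_gens_def extend_path_def fun_eq_iff)

context k_graph
begin

lemma right_module_simplex: "right_module \<Lambda> (simplex_module \<Lambda> n)"
proof (cases "n = -1")
  case True
  then show ?thesis by (simp add: simplex_module_def right_module_const)
next
  case False
  have len: "length (extend_tuple \<Lambda> \<kappa> ls) = length ls" if "ls \<noteq> []" for \<kappa> ls
    using that by (simp add: extend_tuple_def)
  have last: "last (extend_tuple \<Lambda> \<kappa> ls) = cmp \<Lambda> (last ls) \<kappa>"
    "butlast (extend_tuple \<Lambda> \<kappa> ls) = butlast ls" for \<kappa> ls
    by (simp_all add: extend_tuple_def)
  have ne: "ls \<noteq> []" "last ls \<in> mor \<Lambda>" "src \<Lambda> (last ls) = v" if "ls \<in> tuples \<Lambda> N v" for ls N v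
    using that by (auto simp: tuples_def)
  show ?thesis unfolding simplex_module_span[OF False]
  proof (rule right_module_span)
    fix \<kappa> x assume k: "\<kappa> \<in> mor \<Lambda>" and x: "x \<in> simplex_gens \<Lambda> n (rng \<Lambda> \<kappa>)"
    show "map_option (extend_tuple \<Lambda> \<kappa>) x \<in> simplex_gens \<Lambda> n (src \<Lambda> \<kappa>)"
    proof (cases "n \<ge> 0")
      case True
      then obtain ls where ls: "x = Some ls" "length ls = nat n + 1" "composable \<Lambda> (rng \<Lambda> \<kappa>) ls"
        using x by (auto simp: simplex_gens_def tuples_iff)
      have "ls \<noteq> []" using ls(2) by auto
      then have "extend_tuple \<Lambda> \<kappa> ls \<in> tuples \<Lambda> (nat n + 1) (src \<Lambda> \<kappa>)"
        using extend_last[OF ls(3) k] len[of ls \<kappa>] ls(2) by (simp add: tuples_iff extend_tuple_def)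
      then show ?thesis using True ls(1) by (simp add: simplex_gens_def)
    qed (use x False in \<open>simp add: simplex_gens_def\<close>)
  next
    fix v x assume v: "v \<in> vertices \<Lambda>" and x: "x \<in> simplex_gens \<Lambda> n v"
    show "map_option (extend_tuple \<Lambda> v) x = x"
    proof (cases "n \<ge> 0")
      case True
      then obtain ls where ls: "x = Some ls" "ls \<in> tuples \<Lambda> (nat n + 1) v"
        using x by (auto simp: simplex_gens_def)
      have "cmp \<Lambda> (last ls) v = last ls" using cmp_src[OF ne(2)[OF ls(2)]] ne(3)[OF ls(2)] by simp
      then show ?thesis using ne(1)[OF ls(2)] ls(1) by (simp add: extend_tuple_def)
    qed (use x False in \<open>simp add: simplex_gens_def\<close>)
  next
    fix \<mu> \<nu> x assume m: "\<mu> \<in> mor \<Lambda>" "\<nu> \<in> mor \<Lambda>" "src \<Lambda> \<mu> = rng \<Lambda> \<nu>"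
      and x: "x \<in> simplex_gens \<Lambda> n (rng \<Lambda> \<mu>)"
    show "map_option (extend_tuple \<Lambda> (cmp \<Lambda> \<mu> \<nu>)) x =
        map_option (extend_tuple \<Lambda> \<nu>) (map_option (extend_tuple \<Lambda> \<mu>) x)"
    proof (cases "n \<ge> 0")
      case True
      then obtain ls where ls: "x = Some ls" "ls \<in> tuples \<Lambda> (nat n + 1) (rng \<Lambda> \<mu>)"
        using x by (auto simp: simplex_gens_def)
      have "cmp \<Lambda> (cmp \<Lambda> (last ls) \<mu>) \<nu> = cmp \<Lambda> (last ls) (cmp \<Lambda> \<mu> \<nu>)"
        using ne[OF ls(2)] m by (intro cmp_assoc) simp_all
      then show ?thesis using ls(1) by (simp add: extend_tuple_def)
    qed (use x False in \<open>simp add: simplex_gens_def\<close>)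
  qed
qed

lemma right_module_cube: "right_module \<Lambda> (cube_module k \<Lambda> n)"
proof (cases "n = -1")
  case True
  then show ?thesis by (simp add: cube_module_def right_module_const)
next
  case False
  have elem: "\<exists>\<eta> \<mu>. x = Some (\<eta>, \<mu>) \<and> (\<eta>, \<mu>) \<in> cubes k (path_graph \<Lambda> v) (nat n) \<and> n \<ge> 0"
    if "x \<in> cube_gens k \<Lambda> n v" for x v
    using that False by (auto simp: cube_gens_def split: if_splits)
  show ?thesis unfolding cube_module_span[OF False]
  proof (rule right_module_span)
    fix \<kappa> x assume k: "\<kappa> \<in> mor \<Lambda>" and "x \<in> cube_gens k \<Lambda> n (rng \<Lambda> \<kappa>)"
    then obtain \<eta> \<mu> where "x = Some (\<eta>, \<mu>)" "(\<eta>, \<mu>) \<in> cubes k (path_graph \<Lambda> (rng \<Lambda> \<kappa>)) (nat n)" "n \<ge> 0"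
      using elem by blast
    then show "map_option (extend_path \<Lambda> \<kappa>) x \<in> cube_gens k \<Lambda> n (src \<Lambda> \<kappa>)"
      using k by (simp add: cube_gens_def cubes_def extend_path_def cmp_mor src_cmp rng_cmp image_iff)
  next
    fix v x assume v: "v \<in> vertices \<Lambda>" and "x \<in> cube_gens k \<Lambda> n v"
    then obtain \<eta> \<mu> where x: "x = Some (\<eta>, \<mu>)" "(\<eta>, \<mu>) \<in> cubes k (path_graph \<Lambda> v) (nat n)"
      using elem by blast
    then have "\<mu> \<in> mor \<Lambda>" "src \<Lambda> \<mu> = v" by (simp_all add: cubes_def)
    then show "map_option (extend_path \<Lambda> v) x = x"
      using cmp_src[of \<mu>] x(1) by (simp add: extend_path_def)
  next
    fix \<mu> \<nu> x assume m: "\<mu> \<in> mor \<Lambda>" "\<nu> \<in> mor \<Lambda>" "src \<Lambda> \<mu> = rng \<Lambda> \<nu>"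
      and "x \<in> cube_gens k \<Lambda> n (rng \<Lambda> \<mu>)"
    then obtain \<eta> \<rho> where x: "x = Some (\<eta>, \<rho>)" "(\<eta>, \<rho>) \<in> cubes k (path_graph \<Lambda> (rng \<Lambda> \<mu>)) (nat n)"
      using elem by blast
    then have "\<rho> \<in> mor \<Lambda>" "src \<Lambda> \<rho> = rng \<Lambda> \<mu>" by (simp_all add: cubes_def)
    then show "map_option (extend_path \<Lambda> (cmp \<Lambda> \<mu> \<nu>)) x =
        map_option (extend_path \<Lambda> \<nu>) (map_option (extend_path \<Lambda> \<mu>) x)"
      using cmp_assoc[of \<rho> \<mu> \<nu>] m x(1) by (simp add: extend_path_def)
  qed
qed

section \<open>The chain map\<close>

lemma cube_sum_keys:
  assumes "composable \<Lambda> v ls" "length ls = Suc N" "K \<subseteq> {1..k}" "card K = N"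
  shows "Poly_Mapping.keys (cube_sum \<Lambda> (composite \<Lambda> ls) (cumdeg \<Lambda> ls) (rank K) K) \<subseteq>
    Some ` cubes k (path_graph \<Lambda> v) N"
proof -
  have k: "composite \<Lambda> ls \<in> mor \<Lambda>" "src \<Lambda> (composite \<Lambda> ls) = v"
    using composite_props[OF assms(1)] by simp_all
  have "cube \<Lambda> (composite \<Lambda> ls) m K \<in> cubes k (path_graph \<Lambda> v) N"
    if "m \<in> stage_box (cumdeg \<Lambda> ls) (rank K) K" for m
    using cube_in_cubes[OF k(1) stage_box_rank_bound(2)[OF assms(1,3) _ that] assms(3)] assms(2,4) k(2)
    by simp
  then show ?thesis
    unfolding cube_sum_def using keys_sum[of "\<lambda>m. gen \<Lambda> (composite \<Lambda> ls) m K"] by fastforce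
qed

text \<open>The boxes involve partial products of at most as many factors as \<open>K\<close> has elements, which excludes
  the last entry; so they are the same for both tuples, and each cube is acted on through \<open>cube_prefix\<close>.\<close>

lemma square_natural:
  assumes "\<kappa> \<in> mor \<Lambda>" "composable \<Lambda> (rng \<Lambda> \<kappa>) ls" "length ls = Suc N"
  shows "square k \<Lambda> (int N) (src \<Lambda> \<kappa>) (frag_of (Some (extend_tuple \<Lambda> \<kappa> ls))) =
    frag_extend (\<lambda>x. frag_of (map_option (extend_path \<Lambda> \<kappa>) x))
      (square k \<Lambda> (int N) (rng \<Lambda> \<kappa>) (frag_of (Some ls)))"
proof -
  let ?ls = "extend_tuple \<Lambda> \<kappa> ls" and ?ext = "frag_extend (\<lambda>x. frag_of (map_option (extend_path \<Lambda> \<kappa>) x))"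
  have e: "composable \<Lambda> (src \<Lambda> \<kappa>) ?ls" "composite \<Lambda> ?ls = cmp \<Lambda> (composite \<Lambda> ls) \<kappa>"
    using extend_last[OF assms(2,1)] by (simp_all add: extend_tuple_def)
  have len: "length ?ls = Suc N" using assms(3) by (simp add: extend_tuple_def)
  have c: "composite \<Lambda> ls \<in> mor \<Lambda>" "src \<Lambda> (composite \<Lambda> ls) = rng \<Lambda> \<kappa>"
    using composite_props[OF assms(2)] by simp_all
  have step: "cube_sum \<Lambda> (composite \<Lambda> ?ls) (cumdeg \<Lambda> ?ls) (rank K) K =
      ?ext (cube_sum \<Lambda> (composite \<Lambda> ls) (cumdeg \<Lambda> ls) (rank K) K)"
    if K: "K \<subseteq> {1..k}" "card K = N" for K
  proof -
    have fin: "finite K" using K finite_subset by blast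
    have "stage_box (cumdeg \<Lambda> ?ls) (rank K) K = stage_box (cumdeg \<Lambda> ls) (rank K) K"
      unfolding stage_box_def
    proof (rule box_cong)
      have same: "cumdeg \<Lambda> ?ls q = cumdeg \<Lambda> ls q" if "q \<le> N" for q
        unfolding extend_tuple_def using that assms(3) by (intro cumdeg_extend_last) simp
      show "cumdeg \<Lambda> ?ls (rank K j) j = cumdeg \<Lambda> ls (rank K j) j" for j
        using same rank_le_card[OF fin, of j] K(2) by simp
      show "cumdeg \<Lambda> ?ls (Suc (rank K j)) j = cumdeg \<Lambda> ls (Suc (rank K j)) j" if "j \<in> K" for j
        using same rank_less_card[OF fin that] K(2) by simp
    qed
    moreover have "gen \<Lambda> (composite \<Lambda> ?ls) m K = ?ext (gen \<Lambda> (composite \<Lambda> ls) m K)"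
      if "m \<in> stage_box (cumdeg \<Lambda> ls) (rank K) K" for m
      using cube_prefix[OF c(1) assms(1) c(2) stage_box_rank_bound(2)[OF assms(2) K(1) _ that]]
        K(2) assms(3)
      by (simp add: e(2) extend_path_def case_prod_unfold)
    ultimately show ?thesis
      by (simp add: cube_sum_def frag_extend_sum finite_stage_box fin)
  qed
  have finsub: "finite {K. K \<subseteq> {1..k} \<and> card K = N}" by simp
  show ?thesis
    unfolding square_of_tuple[OF e(1) len] square_of_tuple[OF assms(2,3)] frag_extend_sum[OF finsub]
    by (rule sum.cong) (simp_all add: step)
qed

lemma module_map_square: "module_map \<Lambda> (simplex_module \<Lambda> n) (cube_module k \<Lambda> n) (square k \<Lambda> n)"
proof (cases "n = -1")
  case True
  have "module_map \<Lambda> const_module const_module (square k \<Lambda> (-1))"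
    unfolding const_module_span square_def
    by (rule module_map_span) (simp_all add: right_module_const flip: const_module_span)
  then show ?thesis using True by (simp add: simplex_module_def cube_module_def)
next
  case False
  define f :: "'a \<Rightarrow> 'a list option \<Rightarrow> ('a \<times> 'a) option \<Rightarrow>\<^sub>0 int"
    where "f v x = square k \<Lambda> n v (frag_of x)" for v x
  have sq: "square k \<Lambda> n = (\<lambda>v. frag_extend (f v))"
    unfolding f_def[abs_def] by (simp add: square_def fun_eq_iff)
  have elem: "\<exists>ls. x = Some ls \<and> length ls = Suc (nat n) \<and> composable \<Lambda> v ls \<and> n \<ge> 0"
    if "x \<in> simplex_gens \<Lambda> n v" for x v
    using that False by (auto simp: simplex_gens_def tuples_iff split: if_splits)
  have "module_map \<Lambda> (span_module (simplex_gens \<Lambda> n) (\<lambda>\<kappa>. map_option (extend_tuple \<Lambda> \<kappa>)))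
     (span_module (cube_gens k \<Lambda> n) (\<lambda>\<kappa>. map_option (extend_path \<Lambda> \<kappa>))) (\<lambda>v. frag_extend (f v))"
  proof (rule module_map_span)
    fix v x assume "v \<in> vertices \<Lambda>" "x \<in> simplex_gens \<Lambda> n v"
    then obtain ls where ls: "x = Some ls" "length ls = Suc (nat n)" "composable \<Lambda> v ls" "n \<ge> 0"
      using elem by blast
    have "Poly_Mapping.keys (square k \<Lambda> (int (nat n)) v (frag_of (Some ls))) \<subseteq>
        Some ` cubes k (path_graph \<Lambda> v) (nat n)"
      unfolding square_of_tuple[OF ls(3,2)]
      by (rule order_trans[OF keys_sum]) (use cube_sum_keys[OF ls(3,2)] in blast)
    then show "Poly_Mapping.keys (f v x) \<subseteq> cube_gens k \<Lambda> n v"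
      using ls by (simp add: f_def cube_gens_def)
  next
    fix \<kappa> x assume k: "\<kappa> \<in> mor \<Lambda>" and "x \<in> simplex_gens \<Lambda> n (rng \<Lambda> \<kappa>)"
    then obtain ls where ls: "x = Some ls" "length ls = Suc (nat n)" "composable \<Lambda> (rng \<Lambda> \<kappa>) ls" "n \<ge> 0"
      using elem by blast
    show "f (src \<Lambda> \<kappa>) (map_option (extend_tuple \<Lambda> \<kappa>) x) =
        frag_extend (\<lambda>y. frag_of (map_option (extend_path \<Lambda> \<kappa>) y)) (f (rng \<Lambda> \<kappa>) x)"
      using square_natural[OF k ls(3,2)] ls(1,4) by (simp add: f_def)
  qed (use right_module_simplex[of n] right_module_cube[of n] in
      \<open>simp_all add: simplex_module_span[OF False] cube_module_span[OF False]\<close>)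
  then show ?thesis unfolding simplex_module_span[OF False] cube_module_span[OF False] sq .
qed

lemma carrier_simplex_module:
  "carrier (grp (simplex_module \<Lambda> n) v) = {x. Poly_Mapping.keys x \<subseteq> simplex_gens \<Lambda> n v}"
  by (auto simp: simplex_module_def const_module_def simplex_gens_def)

lemma square_boundary_gen:
  assumes "x \<in> simplex_gens \<Lambda> n v"
  shows "square k \<Lambda> (n - 1) v (simplex_boundary \<Lambda> n v (frag_of x)) =
    cube_module_boundary k \<Lambda> n v (square k \<Lambda> n v (frag_of x))"
proof -
  consider "n < 0" | "n = 0" | "n \<ge> 1" by linarith
  then show ?thesis
  proof cases
    case 1
    then have "n = -1" "x = None" using assms by (auto simp: simplex_gens_def split: if_splits)
    then show ?thesis by (simp add: simplex_boundary_def square_def cube_module_boundary_def cube_boundary_def)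
  next
    case 2
    then obtain ls where ls: "x = Some ls" "length ls = Suc 0" "composable \<Lambda> v ls"
      using assms by (auto simp: simplex_gens_def tuples_iff)
    have "{K. K \<subseteq> {1..k} \<and> card K = 0} = {{}}" by (auto simp: finite_subset[OF _ finite_atLeastAtMost])
    moreover have "stage_box (cumdeg \<Lambda> ls) (rank {}) {} = {0}"
      by (auto simp: stage_box_def box_def rank_def fun_eq_iff)
    ultimately have "square k \<Lambda> 0 v (frag_of x) = gen \<Lambda> (composite \<Lambda> ls) 0 {}"
      using square_of_tuple[OF ls(3,2)] ls(1) by (simp add: cube_sum_def)
    then show ?thesis
      using 2 ls(1) by (simp add: simplex_boundary_def cube_module_boundary_def cube_boundary_def)
        (simp add: square_def)
  next
    case 3
    then obtain ls where ls: "x = Some ls" "length ls = Suc (nat n)" "composable \<Lambda> v ls"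
      using assms by (auto simp: simplex_gens_def tuples_iff)
    have "nat n \<ge> 1" "int (nat n) = n" using 3 by simp_all
    then show ?thesis
      using boundary_square_tuple[OF ls(3,2)] ls(1) by (simp add: cube_module_boundary_def)
  qed
qed

end

theorem theorem7p11:
  fixes k :: nat and \<Lambda> :: "'a kgraph"
  assumes "k_graph k \<Lambda>"
  shows "chain_map \<Lambda> (simplex_module \<Lambda>) (simplex_boundary \<Lambda>)
           (cube_module k \<Lambda>) (cube_module_boundary k \<Lambda>) (square k \<Lambda>)"
proof -
  interpret k_graph k \<Lambda> by (rule assms)
  show ?thesis
    unfolding chain_map_def
  proof (intro conjI allI ballI module_map_square)
    fix n v x assume "x \<in> carrier (grp (simplex_module \<Lambda> n) v)"
    then have "Poly_Mapping.keys x \<subseteq> simplex_gens \<Lambda> n v" by (simp add: carrier_simplex_module)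
    then show "square k \<Lambda> (n - 1) v (simplex_boundary \<Lambda> n v x) =
        cube_module_boundary k \<Lambda> n v (square k \<Lambda> n v x)"
    proof (induction x rule: frag_induction)
      case (one x)
      then show ?case by (rule square_boundary_gen)
    qed (simp_all add: square_def simplex_boundary_def cube_module_boundary_def cube_boundary_def
        frag_extend_diff)
  qed
qed

end
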